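(* Let $\eta<\xi$ and let $f:[\eta,\xi]\to\mathbb{R}$ be such that $f''$ is continuous on $[\eta,\xi]$ and bounded away from $0$ there (one-sided derivatives at the endpoints). Suppose that $0<\theta<1$ and $f''\in\mathrm{Lip}_\theta([\eta,\xi])$. For $Q\ge1$, $\delta>0$ let $$N(Q,\delta)=\mathrm{card}\{(a,q)\in\mathbb{Z}\times\mathbb{N} : q\le Q,\ \eta q<a\le \xi q,\ \|qf(a/q)\|<\delta\}.$$ Then for every $\varepsilon>0$, all $Q\ge1$ and $0<\delta<\tfrac12$, $$N(Q,\delta)\ll \delta Q^2+\delta^{-1/2}Q^{\frac12+\varepsilon}+\delta^{\frac{\theta-1}{2}}Q^{\frac{3-\theta}{2}},$$ where the implied constant depends on $f,\eta,\xi,\theta,\varepsilon$.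
   Context: $\|x\|$ is the distance from $x$ to the nearest integer. $g\in\mathrm{Lip}_\theta([\eta,\xi])$ means there is $C>0$ with $|g(x)-g(y)|\le C|x-y|^\theta$ for all $x,y\in[\eta,\xi]$. *)

theory Defs
  imports "HOL-Analysis.Analysis"
begin

definition nearest_int_dist :: "real \<Rightarrow> real" where
  "nearest_int_dist x = \<bar>x - of_int (round x)\<bar>"

definition holder_on :: "real \<Rightarrow> real set \<Rightarrow> (real \<Rightarrow> real) \<Rightarrow> bool" where
  "holder_on \<theta> S g \<longleftrightarrow>
    (\<exists>C>0. \<forall>x\<in>S. \<forall>y\<in>S. \<bar>g x - g y\<bar> \<le> C * \<bar>x - y\<bar> powr \<theta>)"

definition near_curve_points ::
    "(real \<Rightarrow> real) \<Rightarrow> real \<Rightarrow> real \<Rightarrow> real \<Rightarrow> real \<Rightarrow> (int \<times> nat) set" where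
  "near_curve_points f \<eta> \<xi> Q \<delta> =
    {(a, q). 1 \<le> q \<and> real q \<le> Q \<and>
      \<eta> * real q < of_int a \<and> of_int a \<le> \<xi> * real q \<and>
      nearest_int_dist (real q * f (of_int a / real q)) < \<delta>}"

definition near_curve_count ::
    "(real \<Rightarrow> real) \<Rightarrow> real \<Rightarrow> real \<Rightarrow> real \<Rightarrow> real \<Rightarrow> nat" where
  "near_curve_count f \<eta> \<xi> Q \<delta> = card (near_curve_points f \<eta> \<xi> Q \<delta>)"

text \<open>The rounding convention at half-integers is immaterial.\<close>

lemma nearest_int_dist_eq_infdist: "nearest_int_dist x = infdist x \<int>"
proof (rule antisym)
  have "(\<int> :: real set) \<noteq> {}"
    using Ints_0 by blast
  then show "nearest_int_dist x \<le> infdist x \<int>"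
    unfolding infdist_notempty[OF \<open>\<int> \<noteq> {}\<close>]
    by (rule cINF_greatest)
      (auto simp: Ints_def nearest_int_dist_def dist_real_def round_diff_minimal)
  show "infdist x \<int> \<le> nearest_int_dist x"
    using infdist_le[of "of_int (round x)" \<int> x]
    by (simp add: nearest_int_dist_def dist_real_def)
qed

text \<open>Hence \<^const>\<open>card\<close> above is the true cardinality.\<close>

lemma finite_near_curve_points: "finite (near_curve_points f \<eta> \<xi> Q \<delta>)"
proof (rule finite_subset)
  show "near_curve_points f \<eta> \<xi> Q \<delta> \<subseteq>
    (\<Union>q\<in>{..nat \<lfloor>Q\<rfloor>}. {\<lfloor>\<eta> * real q\<rfloor>..\<lfloor>\<xi> * real q\<rfloor>} \<times> {q})"
  proof
    fix z assume "z \<in> near_curve_points f \<eta> \<xi> Q \<delta>"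
    then obtain a :: int and q :: nat where z: "z = (a, q)" and q: "real q \<le> Q"
      and a: "\<eta> * real q < of_int a" "of_int a \<le> \<xi> * real q"
      by (auto simp: near_curve_points_def)
    have "q \<le> nat \<lfloor>Q\<rfloor>" using q by (simp add: le_nat_floor)
    moreover have "\<lfloor>\<eta> * real q\<rfloor> \<le> a" using a(1) by linarith
    moreover have "a \<le> \<lfloor>\<xi> * real q\<rfloor>" using a(2) by (simp add: le_floor_iff)
    ultimately show "z \<in> (\<Union>q\<in>{..nat \<lfloor>Q\<rfloor>}. {\<lfloor>\<eta> * real q\<rfloor>..\<lfloor>\<xi> * real q\<rfloor>} \<times> {q})"
      using z by auto
  qed
qed auto

end

theory Submission
  imports Defs
begin

text \<open>A point $a/q$ counted by $N(Q,\delta)$ gives an integer vector $(q,a,b)$ lying near the cone over the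
  curve $(1,x,f(x))$. Cut the interval into arcs of length $1/T$ with $T \asymp \sqrt{Q/\delta}$. Over one arc
  the vectors lie in a box which, after the unimodular linear change of coordinates attached to the arc,
  is a cube of side $r = \sqrt{Q\delta}$, so their number is
  $\ll r^3 + r^2(1/\lambda + 1/\lambda^*)$, where $\lambda, \lambda^*$ are the lengths of the shortest
  vectors of the lattice and of its dual. Summed over the arcs, the first term is $\delta Q^2$.
  For the second one, fix $1/2 < s < 1$. As in the method of Eskin, Margulis and Mozes, passing from
  scale $T$ to scale $KT$ contracts the average of $\lambda^{-s} + (\lambda^*)^{-s}$ over the arcs up to an
  additive constant, because curvature makes any fixed vector long on most of the finer arcs;
  hence this average is bounded uniformly in $T$. With $\lambda \gg 1/T$ this yields the bound
  $\delta Q^2 + \delta^{s/2} Q^{2-s/2}$ for $\delta Q \ge 1$. At $s = (1+\theta)/2$ its second term is the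
  geometric mean of $\delta Q^2$ and $\delta^{(\theta-1)/2} Q^{(3-\theta)/2}$. The case $\delta Q < 1$ follows
  from $\delta = 1/Q$ by monotonicity.\<close>

section \<open>Integer vectors in moving frames\<close>

text \<open>The range of s is forced. Along an arc the coordinates of a fixed vector (q,a,b) satisfy
  psi' = q and phi' = f'' psi, so phi behaves like a quadratic in the parameter. At worst it nearly
  vanishes around one index i0, and from the i-th of K finer arcs the vector still has length at
  least a constant times m/K * max(1, (i - i0)^2), where m is its coarse length. The sum of the
  (-s)-th powers of max(1, (i - i0)^2) is bounded uniformly in K just when s > 1/2; averaging over
  the K arcs then leaves the factor K^(s-1), which is small for large K just when s < 1. The
  obstacle is that the shortest vector differs from one finer arc to another. A competitor not
  parallel to the coarse shortest vector spans a plane with it, and this plane is a vector of the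
  dual lattice, so the recursion does not close for \<lambda> alone. The dual frame follows, up to
  sign, the Legendre transform of f, which is curved as well; hence one notion
  \<open>regular_path\<close> serves both lattices and their averages are bounded together.\<close>

type_synonym ivec = "int \<times> int \<times> int"

text \<open>The frame attached to the point with parameter $x$ is $(x, f(x), f'(x))$. In it, an integer vector
  $(q,a,b)$ has the coordinates $q$, $qx - a$ and $b - q f(x) + f'(x)(qx - a)$.\<close>

type_synonym frame = "real \<times> real \<times> real"

fun psi :: "frame \<Rightarrow> ivec \<Rightarrow> real" where
  "psi (X, Y, P) (q, a, b) = of_int q * X - of_int a"

fun phi :: "frame \<Rightarrow> ivec \<Rightarrow> real" where
  "phi (X, Y, P) (q, a, b) = of_int b - of_int q * Y + P * (of_int q * X - of_int a)"

text \<open>The weights 1/T, 1, T have product 1, so the covolume stays 1. At T = sqrt(Q/\<delta>)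
  the conditions |q| \<le> Q and |phi| \<le> \<delta> both become a bound by sqrt(Q
  \<delta>).\<close>

definition nrm :: "real \<Rightarrow> frame \<Rightarrow> ivec \<Rightarrow> real" where
  "nrm T F v = max (\<bar>of_int (fst v)\<bar> / T) (max \<bar>psi F v\<bar> (T * \<bar>phi F v\<bar>))"

text \<open>Projective duality of curves: the dual lattice is again described by a frame, with the roles
  of point and tangent exchanged.\<close>

fun dual :: "frame \<Rightarrow> frame" where
  "dual (X, Y, P) = (- P, X * P - Y, - X)"

fun cross :: "ivec \<Rightarrow> ivec \<Rightarrow> ivec" where
  "cross (q, a, b) (q', a', b') = (q' * a - q * a', q * b' - q' * b, a' * b - a * b')"

fun pairing :: "ivec \<Rightarrow> ivec \<Rightarrow> int" where
  "pairing (q, a, b) (q', a', b') = q * b' + a * a' + b * q'"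

lemma dual_dual [simp]: "dual (dual F) = F"
  by (cases F) (auto simp: algebra_simps)

text \<open>Up to sign these are the 2 by 2 minors of the coordinates of \<open>v\<close> and
  \<open>w\<close> in the frame \<open>F\<close>: the vector product commutes with the unimodular
  change of coordinates, provided that the result is read in the dual frame.\<close>

lemma cross_coords:
  "of_int (fst (cross v w)) = of_int (fst v) * psi F w - of_int (fst w) * psi F v"
  "psi (dual F) (cross v w) = - (of_int (fst v) * phi F w - of_int (fst w) * phi F v)"
  "phi (dual F) (cross v w) = psi F v * phi F w - psi F w * phi F v"
  by (cases F; cases v; cases w; simp add: algebra_simps)+

lemma pairing_coords:
  "of_int (pairing v w) = of_int (fst v) * phi (dual F) w + psi F v * psi (dual F) w + phi F v * of_int (fst w)"
  by (cases F; cases v; cases w; simp add: algebra_simps)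

lemma psi_diff: "psi F (v - w) = psi F v - psi F w"
  by (cases F; cases v; cases w; simp add: algebra_simps)

lemma phi_diff: "phi F (v - w) = phi F v - phi F w"
  by (cases F; cases v; cases w; simp add: algebra_simps)

lemma cross_diff: "cross (v - w) u = cross v u - cross w u"
  by (cases u; cases v; cases w; simp add: algebra_simps)

lemma pairing_diff: "pairing (v - w) u = pairing v u - pairing w u"
  by (cases u; cases v; cases w; simp add: algebra_simps)

lemma nrm_le_iff: "nrm T F v \<le> r \<longleftrightarrow> \<bar>of_int (fst v)\<bar> / T \<le> r \<and> \<bar>psi F v\<bar> \<le> r \<and> T * \<bar>phi F v\<bar> \<le> r"
  by (auto simp: nrm_def)

lemma nrm_bounds:
  "\<bar>of_int (fst v)\<bar> / T \<le> nrm T F v" "\<bar>psi F v\<bar> \<le> nrm T F v" "T * \<bar>phi F v\<bar> \<le> nrm T F v"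
  by (auto simp: nrm_def)

lemma nrm_nonneg: "0 \<le> nrm T F v"
  using nrm_bounds(2)[of F v T] by linarith

lemma nrm_eq_0: assumes "0 < T" "nrm T F v = 0" shows "v = 0"
proof -
  have "fst v = 0" "psi F v = 0" "phi F v = 0"
    using nrm_bounds[where T=T and F=F and v=v] assms
    by (auto simp: divide_le_0_iff mult_le_0_iff)
  then show ?thesis by (cases F; cases v) (auto simp: zero_prod_def)
qed

lemma nrm_pos: "0 < T \<Longrightarrow> v \<noteq> 0 \<Longrightarrow> 0 < nrm T F v"
  using nrm_eq_0[of T F v] nrm_nonneg[of T F v] by fastforce

lemma nrm_diff: assumes "0 < T" shows "nrm T F (v - w) \<le> nrm T F v + nrm T F w"
proof -
  have "\<bar>of_int (fst (v - w))\<bar> / T \<le> \<bar>of_int (fst v)\<bar> / T + \<bar>of_int (fst w)\<bar> / T"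
    using assms by (simp add: fst_diff divide_simps)
  moreover have "T * \<bar>phi F (v - w)\<bar> \<le> T * \<bar>phi F v\<bar> + T * \<bar>phi F w\<bar>"
    unfolding phi_diff distrib_left[symmetric] using assms
    by (intro mult_left_mono) auto
  ultimately show ?thesis
    unfolding nrm_le_iff psi_diff
    using nrm_bounds[where T=T and F=F and v=v] nrm_bounds[where T=T and F=F and v=w] by linarith
qed

text \<open>The exterior square of the lattice of integer vectors is its dual, and this identification
  carries one frame to the other.\<close>

lemma nrm_cross: assumes "0 < T"
  shows "nrm T (dual F) (cross v w) \<le> 2 * nrm T F v * nrm T F w"
proof -
  have *: "\<bar>a * d - c * b\<bar> \<le> 2 * m * n"
    if "\<bar>a\<bar> \<le> m" "\<bar>b\<bar> \<le> m" "\<bar>c\<bar> \<le> n" "\<bar>d\<bar> \<le> n" for a b c d m n :: real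
  proof -
    have "\<bar>a * d\<bar> \<le> m * n" "\<bar>c * b\<bar> \<le> n * m"
      unfolding abs_mult using that by (intro mult_mono; linarith)+
    then show ?thesis by (simp add: mult.commute[of n m])
  qed
  note bv = nrm_bounds[where T=T and F=F and v=v]
  note bw = nrm_bounds[where T=T and F=F and v=w]
  have v1: "\<bar>of_int (fst v) / T\<bar> \<le> nrm T F v" and w1: "\<bar>of_int (fst w) / T\<bar> \<le> nrm T F w"
    and v3: "\<bar>T * phi F v\<bar> \<le> nrm T F v" and w3: "\<bar>T * phi F w\<bar> \<le> nrm T F w"
    using bv bw assms by (auto simp: abs_mult)
  have 1: "\<bar>of_int (fst (cross v w))\<bar> / T \<le> 2 * nrm T F v * nrm T F w"
    using *[OF v1 bv(2) w1 bw(2)] assms unfolding cross_coords(1)[where F=F]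
    by (simp add: diff_divide_distrib[symmetric])
  have 2: "\<bar>psi (dual F) (cross v w)\<bar> \<le> 2 * nrm T F v * nrm T F w"
    using *[OF v1 v3 w1 w3] assms unfolding cross_coords(2)
    by (simp add: diff_divide_distrib[symmetric])
  have 3: "T * \<bar>phi (dual F) (cross v w)\<bar> \<le> 2 * nrm T F v * nrm T F w"
  proof -
    have "T * \<bar>phi (dual F) (cross v w)\<bar> = \<bar>psi F v * (T * phi F w) - psi F w * (T * phi F v)\<bar>"
      unfolding cross_coords(3) using assms
      by (subst abs_of_pos[OF assms, symmetric], subst abs_mult[symmetric]) (simp add: algebra_simps)
    then show ?thesis using *[OF bv(2) v3 bw(2) w3] by simp
  qed
  show ?thesis unfolding nrm_le_iff using 1 2 3 by blast
qed

lemma pairing_le: assumes "0 < T"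
  shows "\<bar>of_int (pairing v w)\<bar> \<le> 3 * nrm T F v * nrm T (dual F) w"
proof -
  let ?m = "nrm T F v" and ?n = "nrm T (dual F) w"
  note bv = nrm_bounds[where T=T and F=F and v=v]
  note bw = nrm_bounds[where T=T and F="dual F" and v=w]
  have "of_int (pairing v w) = (of_int (fst v) / T) * (T * phi (dual F) w) + psi F v * psi (dual F) w
      + (T * phi F v) * (of_int (fst w) / T)"
    using assms unfolding pairing_coords[where F=F] by simp
  moreover have "\<bar>(of_int (fst v) / T) * (T * phi (dual F) w)\<bar> \<le> ?m * ?n"
    unfolding abs_mult[of "_ / _"] using bv bw assms by (intro mult_mono) (auto simp: abs_mult nrm_nonneg)
  moreover have "\<bar>psi F v * psi (dual F) w\<bar> \<le> ?m * ?n"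
    unfolding abs_mult using bv bw assms by (intro mult_mono) (auto simp: nrm_nonneg)
  moreover have "\<bar>(T * phi F v) * (of_int (fst w) / T)\<bar> \<le> ?m * ?n"
    unfolding abs_mult[of _ "_ / _"] using bv bw assms by (intro mult_mono) (auto simp: abs_mult nrm_nonneg)
  moreover have "\<bar>x + y + z\<bar> \<le> 3 * k" if "\<bar>x\<bar> \<le> k" "\<bar>y\<bar> \<le> k" "\<bar>z\<bar> \<le> k" for x y z k :: real
    using that by linarith
  ultimately show ?thesis by (simp only: mult.assoc)
qed

text \<open>The ratio is real because a shortest vector in a given direction is not known to divide
  the other integer vectors of that direction; only the size of the ratio matters.\<close>

definition scaled :: "real \<Rightarrow> ivec \<Rightarrow> ivec \<Rightarrow> bool" where
  "scaled t v w \<longleftrightarrow> of_int (fst w) = t * of_int (fst v) \<and>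
    of_int (fst (snd w)) = t * of_int (fst (snd v)) \<and> of_int (snd (snd w)) = t * of_int (snd (snd v))"

lemma nrm_scaled: assumes "scaled t v w" "0 < T" shows "nrm T F w = \<bar>t\<bar> * nrm T F v"
proof -
  have "psi F w = t * psi F v" "phi F w = t * phi F v"
    using assms(1) by (cases F; cases v; cases w; simp add: scaled_def algebra_simps)+
  moreover have "of_int (fst w) = t * of_int (fst v)" using assms by (simp add: scaled_def)
  moreover have "max (\<bar>t\<bar> * x) (\<bar>t\<bar> * y) = \<bar>t\<bar> * max x y" for x y
    by (simp add: max_mult_distrib_left)
  ultimately show ?thesis unfolding nrm_def
    by (simp add: abs_mult max_mult_distrib_left mult.left_commute)
qed

lemma scaled_of_cross_eq_0:
  assumes "cross v w = 0" "v \<noteq> 0" shows "\<exists>t. scaled t v w"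
proof -
  obtain q a b q' a' b' where vw: "v = (q, a, b)" "w = (q', a', b')" by (metis surj_pair)
  have e: "q' * a = q * a'" "q * b' = q' * b" "a' * b = a * b'"
    using assms(1) by (auto simp: vw zero_prod_def)
  have e': "real_of_int q' * a = q * a'" "real_of_int q * b' = q' * b" "real_of_int a' * b = a * b'"
    using e by (metis of_int_mult)+
  consider "q \<noteq> 0" | "a \<noteq> 0" | "b \<noteq> 0" using assms(2) by (auto simp: vw zero_prod_def)
  then show ?thesis
  proof cases
    case 1 then show ?thesis
      using e' by (intro exI[of _ "of_int q' / of_int q"]) (auto simp: scaled_def vw field_simps)
  next
    case 2 then show ?thesis
      using e' by (intro exI[of _ "of_int a' / of_int a"]) (auto simp: scaled_def vw field_simps)
  next
    case 3 then show ?thesis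
      using e' by (intro exI[of _ "of_int b' / of_int b"]) (auto simp: scaled_def vw field_simps)
  qed
qed

text \<open>The double vector product expands into a combination of \<open>u\<close> and
  \<open>w\<close> whose coefficients are the two pairings with \<open>c\<close>. Consequently, for
  vectors in the plane annihilated by \<open>c\<close>, the vector product amounts to one real
  number, the ratio to \<open>c\<close>.\<close>

lemma cross_cross_eq_0:
  assumes "pairing u c = 0" "pairing w c = 0" shows "cross c (cross u w) = 0"
proof -
  obtain q a b q' a' b' x y z where e: "u = (q, a, b)" "w = (q', a', b')" "c = (x, y, z)"
    by (metis surj_pair)
  have *: "q * z + a * y + b * x = 0" "q' * z + a' * y + b' * x = 0"
    using assms by (simp_all add: e)
  have "cross c (cross u w) =
      (q' * (q * z + a * y + b * x) - q * (q' * z + a' * y + b' * x),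
       a' * (q * z + a * y + b * x) - a * (q' * z + a' * y + b' * x),
       b' * (q * z + a * y + b * x) - b * (q' * z + a' * y + b' * x))"
    unfolding e by (simp add: algebra_simps)
  then show ?thesis unfolding * by (simp add: zero_prod_def)
qed

lemma finite_nrm_le: assumes "0 < T" shows "finite {v. nrm T F v \<le> r}"
proof -
  obtain X Y P where F: "F = (X, Y, P)" by (metis surj_pair)
  define N where "N = \<lceil>\<bar>r\<bar> * T\<rceil>"
  define M where "M = \<lceil>\<bar>r\<bar> + of_int N * \<bar>X\<bar>\<rceil>"
  define L where "L = \<lceil>\<bar>r\<bar> / T + of_int N * \<bar>Y\<bar> + \<bar>P\<bar> * \<bar>r\<bar>\<rceil>"
  have "{v. nrm T F v \<le> r} \<subseteq> {-N..N} \<times> {-M..M} \<times> {-L..L}"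
  proof
    fix v assume "v \<in> {v. nrm T F v \<le> r}"
    then obtain q a b where v: "v = (q, a, b)" and n: "nrm T F (q, a, b) \<le> r" by (cases v) auto
    have n1: "\<bar>of_int q\<bar> / T \<le> \<bar>r\<bar>" and n2: "\<bar>of_int q * X - of_int a\<bar> \<le> \<bar>r\<bar>"
      and n3: "T * \<bar>of_int b - of_int q * Y + P * (of_int q * X - of_int a)\<bar> \<le> \<bar>r\<bar>"
      using n by (auto simp: nrm_le_iff F)
    have q: "real_of_int \<bar>q\<bar> \<le> of_int N"
      using n1 assms unfolding N_def by (simp add: divide_simps) linarith
    have "\<bar>of_int q * X\<bar> \<le> of_int N * \<bar>X\<bar>" unfolding abs_mult
      using q by (intro mult_right_mono) auto
    then have a: "real_of_int \<bar>a\<bar> \<le> of_int M" using n2 unfolding M_def by simp linarith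
    have "\<bar>of_int q * Y\<bar> \<le> of_int N * \<bar>Y\<bar>" unfolding abs_mult
      using q by (intro mult_right_mono) auto
    moreover have "\<bar>P * (of_int q * X - of_int a)\<bar> \<le> \<bar>P\<bar> * \<bar>r\<bar>" unfolding abs_mult
      using n2 by (intro mult_left_mono) auto
    moreover have "\<bar>of_int b - of_int q * Y + P * (of_int q * X - of_int a)\<bar> \<le> \<bar>r\<bar> / T"
      using n3 assms by (simp add: field_simps)
    ultimately have "real_of_int \<bar>b\<bar> \<le> of_int L" unfolding L_def by simp linarith
    with a q show "v \<in> {-N..N} \<times> {-M..M} \<times> {-L..L}"
      unfolding of_int_le_iff v by auto
  qed
  then show ?thesis by (rule finite_subset) auto
qed

section \<open>The first minimum of the lattice and its lower bound\<close>

definition lam :: "real \<Rightarrow> frame \<Rightarrow> real" where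
  "lam T F = Inf (nrm T F ` (UNIV - {0}))"

lemma finite_min_exists:
  fixes g :: "'a \<Rightarrow> real"
  assumes "\<And>r. finite {v. P v \<and> g v \<le> r}" "P w"
  obtains v where "P v" "\<And>u. P u \<Longrightarrow> g v \<le> g u"
proof -
  have "\<exists>v\<in>{v. P v \<and> g v \<le> g w}. \<forall>u\<in>{v. P v \<and> g v \<le> g w}. g v \<le> g u"
    using assms(1)[of "g w"] assms(2)
    by (metis (mono_tags, lifting) arg_min_if_finite(1) arg_min_least empty_iff mem_Collect_eq order_refl)
  then show ?thesis using that by (smt (verit) mem_Collect_eq)
qed

lemma nonzero_ivec: "(0, 0, 1) \<noteq> (0 :: ivec)"
  by (simp add: zero_prod_def)

lemma lam_attained:
  assumes "0 < T"
  obtains v where "v \<noteq> 0" "nrm T F v = lam T F"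
proof -
  have "finite {v. v \<noteq> 0 \<and> nrm T F v \<le> r}" for r
    using finite_nrm_le[OF assms, of F r] by (rule finite_subset[rotated]) auto
  then obtain v where v: "v \<noteq> 0" "\<And>u. u \<noteq> 0 \<Longrightarrow> nrm T F v \<le> nrm T F u"
    using finite_min_exists[of "\<lambda>v. v \<noteq> 0" "nrm T F", OF _ nonzero_ivec] by blast
  have "lam T F = nrm T F v" unfolding lam_def
    using v by (intro cInf_eq_minimum) auto
  then show ?thesis using that v by simp
qed

lemma lam_le: "v \<noteq> 0 \<Longrightarrow> lam T F \<le> nrm T F v"
  unfolding lam_def by (intro cInf_lower bdd_belowI2[of _ 0]) (auto simp: nrm_nonneg)

lemma lam_pos: "0 < T \<Longrightarrow> 0 < lam T F"
  using lam_attained[of T F] nrm_pos[of T _ F] by metis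

text \<open>The first nonzero entry among q, a, b stands alone in its coordinate, and being an
  integer it contributes at least 1/T, 1 or T respectively. The assumption \<open>T0 \<le> T\<close>
  turns the last two into multiples of 1/T.\<close>

lemma lam_ge:
  assumes "0 < T0" "T0 \<le> T"
  shows "min 1 (min T0 (T0\<^sup>2)) / T \<le> lam T F"
proof -
  have T: "0 < T" using assms by simp
  obtain v where v: "v \<noteq> 0" "nrm T F v = lam T F" using lam_attained[OF T] .
  obtain q a b where vv: "v = (q, a, b)" by (metis surj_pair)
  note b = nrm_bounds[where T=T and F=F and v=v]
  have i1: "1 \<le> \<bar>real_of_int k\<bar>" if "k \<noteq> 0" for k using that by linarith
  consider "q \<noteq> 0" | "q = 0" "a \<noteq> 0" | "q = 0" "a = 0" "b \<noteq> 0"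
    using v(1) by (auto simp: vv zero_prod_def)
  then show ?thesis
  proof cases
    case 1
    have "min 1 (min T0 (T0\<^sup>2)) / T \<le> \<bar>of_int (fst v)\<bar> / T"
      using i1[OF 1] T by (intro divide_right_mono) (auto simp: vv)
    then show ?thesis using b(1) v(2) by linarith
  next
    case 2
    have "1 \<le> \<bar>psi F v\<bar>" using i1[OF 2(2)] 2(1) by (cases F) (auto simp: vv)
    moreover have "min 1 (min T0 (T0\<^sup>2)) / T \<le> 1"
      using assms T by (simp add: divide_le_eq)
    ultimately show ?thesis using b(2) v(2) by linarith
  next
    case 3
    have "1 \<le> \<bar>phi F v\<bar>" using i1[OF 3(3)] 3(1,2) by (cases F) (auto simp: vv)
    then have "T \<le> T * \<bar>phi F v\<bar>" using T by simp
    moreover have "T0\<^sup>2 \<le> T * T" unfolding power2_eq_square using assms by (intro mult_mono) auto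
    then have "min 1 (min T0 (T0\<^sup>2)) / T \<le> T"
      using T by (simp add: divide_le_eq)
    ultimately show ?thesis using b(3) v(2) by linarith
  qed
qed

section \<open>Counting lattice points in cubes\<close>

text \<open>Dirichlet's box principle. Taking for \<open>a j\<close> the integer part of
  \<open>real j * X\<close> already makes \<open>psi\<close> a difference of fractional parts, so
  only \<open>phi\<close> needs boxes: J + 1 values of j fall into J boxes of width 1/J, with J the
  integer part of T.\<close>

lemma lam_le_2: assumes "0 < T" shows "lam T F \<le> 2"
proof (cases "T < 1")
  case True
  have "nrm T F (0, 0, 1) \<le> 2"
    using assms True by (cases F) (simp add: nrm_def)
  then show ?thesis using lam_le[OF nonzero_ivec, of T F] by linarith
next
  case False
  obtain X Y P where F: "F = (X, Y, P)" by (metis surj_pair)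
  define J where "J = nat \<lfloor>T\<rfloor>"
  have J: "1 \<le> J" "real J \<le> T" "T < real J + 1"
    using False unfolding J_def by linarith+
  define a where "a j = \<lfloor>real j * X\<rfloor>" for j
  define z where "z j = P * (real j * X - of_int (a j)) - real j * Y" for j
  define h where "h j = nat \<lfloor>real J * frac (z j)\<rfloor>" for j
  have h: "real (h j) \<le> real J * frac (z j)" "real J * frac (z j) < real (h j) + 1" for j
    unfolding h_def using frac_ge_0[of "z j"] by (simp_all add: zero_le_mult_iff)
  have "h ` {0..J} \<subseteq> {0..<J}"
  proof
    fix k assume "k \<in> h ` {0..J}"
    then obtain j where k: "k = h j" by blast
    have "real J * frac (z j) < real J * 1"
      using J frac_lt_1[of "z j"] by (intro mult_strict_left_mono) auto
    then show "k \<in> {0..<J}" using h(1)[of j] k by simp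
  qed
  then have "\<not> inj_on h {0..J}"
    using card_inj_on_le[of h "{0..J}" "{0..<J}"] by fastforce
  then obtain i j where ij: "i \<le> J" "j \<le> J" "i < j" "h i = h j"
    unfolding inj_on_def by (metis atLeastAtMost_iff linorder_neqE_nat)
  define v :: ivec where "v = (int j - int i, a j - a i, \<lfloor>z i\<rfloor> - \<lfloor>z j\<rfloor>)"
  have v0: "v \<noteq> 0" using ij by (auto simp: v_def zero_prod_def)
  have 1: "\<bar>of_int (fst v)\<bar> / T \<le> 2"
    using ij J by (simp add: v_def divide_simps)
  have "\<bar>psi F v\<bar> = \<bar>frac (real j * X) - frac (real i * X)\<bar>"
    by (simp add: F v_def a_def frac_def algebra_simps)
  then have 2: "\<bar>psi F v\<bar> \<le> 2"
    using frac_ge_0[of "real j * X"] frac_lt_1[of "real j * X"]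
      frac_ge_0[of "real i * X"] frac_lt_1[of "real i * X"] by linarith
  have "phi F v = frac (z j) - frac (z i)"
    by (simp add: F v_def z_def frac_def algebra_simps)
  moreover have "\<bar>real J * frac (z j) - real J * frac (z i)\<bar> < 1"
    using h[of i] h[of j] ij(4) by linarith
  ultimately have *: "real J * \<bar>phi F v\<bar> < 1"
    by (simp add: right_diff_distrib[symmetric] abs_mult)
  have "T * \<bar>phi F v\<bar> \<le> (2 * real J) * \<bar>phi F v\<bar>"
    using J by (intro mult_right_mono) auto
  then have 3: "T * \<bar>phi F v\<bar> \<le> 2" using * by simp
  have "nrm T F v \<le> 2" unfolding nrm_le_iff using 1 2 3 by blast
  then show ?thesis using lam_le[OF v0, of T F] by linarith
qed

lemma nrm_0 [simp]: "nrm T F 0 = 0"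
  using psi_diff[of F 0 0] phi_diff[of F 0 0] by (simp add: nrm_def)

lemma scaled_diff: "scaled t v w \<Longrightarrow> scaled s v u \<Longrightarrow> scaled (t - s) v (w - u)"
  by (simp add: scaled_def algebra_simps)

lemma card_separated:
  fixes h :: "'a \<Rightarrow> real"
  assumes "\<And>u w. u \<in> S \<Longrightarrow> w \<in> S \<Longrightarrow> u \<noteq> w \<Longrightarrow> 1 \<le> \<bar>h u - h w\<bar>"
    and "\<And>u. u \<in> S \<Longrightarrow> \<bar>h u\<bar> \<le> R" and "0 \<le> R"
  shows "real (card S) \<le> 2 * R + 2"
proof -
  have "inj_on (\<lambda>u. \<lfloor>h u\<rfloor>) S"
  proof (rule inj_onI, rule ccontr)
    fix u w assume "u \<in> S" "w \<in> S" "\<lfloor>h u\<rfloor> = \<lfloor>h w\<rfloor>" "u \<noteq> w"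
    then show False using assms(1)[of u w] by linarith
  qed
  moreover have "(\<lambda>u. \<lfloor>h u\<rfloor>) ` S \<subseteq> {\<lfloor>-R\<rfloor>..\<lfloor>R\<rfloor>}"
  proof
    fix k assume "k \<in> (\<lambda>u. \<lfloor>h u\<rfloor>) ` S"
    then obtain u where "u \<in> S" "k = \<lfloor>h u\<rfloor>" by blast
    then show "k \<in> {\<lfloor>-R\<rfloor>..\<lfloor>R\<rfloor>}"
      using assms(2)[of u] by (auto intro!: floor_mono)
  qed
  ultimately have "card S \<le> card {\<lfloor>-R\<rfloor>..\<lfloor>R\<rfloor>}"
    by (intro card_inj_on_le) auto
  also have "real \<dots> \<le> 2 * R + 2" using assms(3) by simp linarith
  finally show ?thesis by simp
qed

lemma card_le_fibres:
  assumes "finite S" "\<And>y. y \<in> h ` S \<Longrightarrow> real (card {x \<in> S. h x = y}) \<le> B"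
    "real (card (h ` S)) \<le> A" "0 \<le> B"
  shows "real (card S) \<le> A * B"
proof -
  have "card S = (\<Sum>y\<in>h ` S. card {x \<in> S. h x = y})"
    unfolding card_eq_sum by (rule sum.image_gen[OF assms(1)])
  then have "real (card S) = (\<Sum>y\<in>h ` S. real (card {x \<in> S. h x = y}))"
    by (metis of_nat_sum)
  also have "\<dots> \<le> real (card (h ` S)) * B"
    using assms(2) by (intro sum_bounded_above) auto
  also have "\<dots> \<le> A * B" using assms(3,4) by (rule mult_right_mono)
  finally show ?thesis .
qed

lemma card_line:
  assumes T: "0 < T" and u: "u \<noteq> 0" and mu: "nrm T F u = \<mu>" and r: "0 \<le> r"
    and par: "\<And>v w. v \<in> S \<Longrightarrow> w \<in> S \<Longrightarrow> cross (v - w) u = 0"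
    and sep: "\<And>v w. v \<in> S \<Longrightarrow> w \<in> S \<Longrightarrow> v \<noteq> w \<Longrightarrow> \<mu> \<le> nrm T F (v - w)"
    and bd: "\<And>v. v \<in> S \<Longrightarrow> nrm T F v \<le> r"
  shows "real (card S) \<le> 4 * r / \<mu> + 2"
proof (cases "S = {}")
  case True
  then show ?thesis using r mu nrm_nonneg[of T F u] by simp
next
  case False
  then obtain v0 where v0: "v0 \<in> S" by blast
  have mu0: "0 < \<mu>" using nrm_pos[OF T u, of F] mu by simp
  have "\<exists>t. scaled t u (v - v0)" if "v \<in> S" for v
  proof -
    have "cross u (v - v0) = - cross (v - v0) u"
      by (cases u; cases "v - v0") simp
    then show ?thesis using par[OF that v0] scaled_of_cross_eq_0[OF _ u] by simp
  qed
  then obtain t where t: "\<And>v. v \<in> S \<Longrightarrow> scaled (t v) u (v - v0)" by metis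
  have "real (card S) \<le> 2 * (2 * r / \<mu>) + 2"
  proof (rule card_separated)
    fix v w assume vw: "v \<in> S" "w \<in> S" "v \<noteq> w"
    have "scaled (t v - t w) u (v - w)"
      using t[OF vw(1)] t[OF vw(2)] by (simp add: scaled_def algebra_simps)
    then have "\<mu> \<le> \<bar>t v - t w\<bar> * \<mu>" using nrm_scaled[OF _ T] sep[OF vw] mu by metis
    then show "1 \<le> \<bar>t v - t w\<bar>" using mu0 by simp
  next
    fix v assume v: "v \<in> S"
    have "\<bar>t v\<bar> * \<mu> = nrm T F (v - v0)"
      using nrm_scaled[OF t[OF v] T, of F] mu by simp
    also have "\<dots> \<le> 2 * r"
      using nrm_diff[OF T, of F v v0] bd[OF v] bd[OF v0] by linarith
    finally have "\<bar>t v\<bar> * \<mu> \<le> 2 * r" .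
    then show "\<bar>t v\<bar> \<le> 2 * r / \<mu>" using mu0 by (simp add: pos_le_divide_eq)
  next
    show "0 \<le> 2 * r / \<mu>" using r mu0 by simp
  qed
  then show ?thesis by simp
qed

text \<open>The plane is cut into lines parallel to its shortest vector \<open>u\<close>. For two
  points of the plane, \<open>cross (v - w) u\<close> is a multiple of \<open>c\<close>; if it is
  nonzero, it is at least as long as the shortest dual vector \<open>c\<close>. So the multiplier
  \<open>t\<close> labels the lines by numbers at mutual distance at least 1.\<close>

lemma card_plane:
  assumes T: "0 < T" and r: "0 \<le> r" and c: "c \<noteq> 0" "nrm T (dual F) c = lam T (dual F)"
    and S: "S \<subseteq> {v. nrm T F v \<le> r \<and> pairing v c = k}"
  shows "real (card S) \<le> 64 * r\<^sup>2 / lam T (dual F) + 8 * r / lam T F + 4"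
proof (cases "\<exists>v\<in>S. \<exists>w\<in>S. v \<noteq> w")
  case False
  then have "card S \<le> 1"
    by (metis card.empty card_1_singleton_iff is_singletonI' is_singleton_altdef linorder_linear zero_le)
  moreover have "0 \<le> 64 * r\<^sup>2 / lam T (dual F)" "0 \<le> 8 * r / lam T F"
    using lam_pos[OF T, of F] lam_pos[OF T, of "dual F"] r by auto
  ultimately show ?thesis by linarith
next
  case True
  then obtain v0 w0 where v0: "v0 \<in> S" "w0 \<in> S" "v0 \<noteq> w0" by blast
  have fin: "finite S" by (rule finite_subset[OF _ finite_nrm_le[OF T, of F r]]) (use S in auto)
  let ?l = "lam T F" and ?m = "lam T (dual F)"
  have lm: "0 < ?l" "0 < ?m" using lam_pos[OF T] by auto
  let ?P = "\<lambda>v. v \<noteq> 0 \<and> pairing v c = 0"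
  have diffP: "?P (v - w)" if "v \<in> S" "w \<in> S" "v \<noteq> w" for v w
    using that S by (auto simp: pairing_diff)
  have diffn: "nrm T F (v - w) \<le> 2 * r" if "v \<in> S" "w \<in> S" for v w
  proof -
    have "nrm T F v \<le> r" "nrm T F w \<le> r" using that S by auto
    then show ?thesis using nrm_diff[OF T, of F v w] by linarith
  qed
  have "finite {v. ?P v \<and> nrm T F v \<le> R}" for R
    by (rule finite_subset[OF _ finite_nrm_le[OF T, of F R]]) auto
  then obtain u where u: "?P u" "\<And>v. ?P v \<Longrightarrow> nrm T F u \<le> nrm T F v"
    using finite_min_exists[of ?P "nrm T F" "v0 - w0"] diffP[OF v0] by blast
  define \<mu> where "\<mu> = nrm T F u"
  \<comment> \<open>The upper bound comes from two distinct points of \<open>S\<close>, which is why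
    a single point was set apart. It turns the mixed term 16 r \<mu> / ?m of the product into one of
    order r^2 / ?m.\<close>
  have mu: "\<mu> \<le> 2 * r" "?l \<le> \<mu>"
    using u diffP[OF v0] diffn[OF v0(1,2)] lam_le[of u T F] unfolding \<mu>_def by fastforce+
  have "\<exists>t. scaled t c (cross (v - v0) u)" if "v \<in> S" for v
  proof -
    have "pairing (v - v0) c = 0" using that v0(1) S by (auto simp: pairing_diff)
    then show ?thesis using cross_cross_eq_0 u(1) scaled_of_cross_eq_0[OF _ c(1)] by blast
  qed
  then obtain t where t: "\<And>v. v \<in> S \<Longrightarrow> scaled (t v) c (cross (v - v0) u)" by metis
  have tdiff: "scaled (t v - t w) c (cross (v - w) u)" if "v \<in> S" "w \<in> S" for v w
  proof -
    have "cross (v - w) u = cross (v - v0) u - cross (w - v0) u"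
      unfolding cross_diff[symmetric] by simp
    then show ?thesis using scaled_diff[OF t[OF that(1)] t[OF that(2)]] by simp
  qed
  have lines: "real (card (t ` S)) \<le> 2 * (4 * r * \<mu> / ?m) + 2"
  proof (rule card_separated[where h="\<lambda>x. x"])
    fix x y assume "x \<in> t ` S" "y \<in> t ` S" "x \<noteq> y"
    then obtain v w where vw: "v \<in> S" "w \<in> S" "x = t v" "y = t w" "t v \<noteq> t w" by blast
    have "cross (v - w) u \<noteq> 0"
    proof
      assume "cross (v - w) u = 0"
      then have "\<bar>t v - t w\<bar> * nrm T (dual F) c = 0"
        using nrm_scaled[OF tdiff[OF vw(1,2)] T, of "dual F"] by simp
      then show False using c lm vw(5) by simp
    qed
    then have "?m \<le> \<bar>t v - t w\<bar> * ?m"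
      using nrm_scaled[OF tdiff[OF vw(1,2)] T, of "dual F"] lam_le[of _ T "dual F"] c(2) by metis
    then show "1 \<le> \<bar>x - y\<bar>" using lm vw by simp
  next
    fix x assume "x \<in> t ` S"
    then obtain v where v: "v \<in> S" "x = t v" by blast
    have "\<bar>t v\<bar> * ?m \<le> 2 * nrm T F (v - v0) * nrm T F u"
      using nrm_scaled[OF t[OF v(1)] T, of "dual F"] nrm_cross[OF T, of F "v - v0" u] c(2) by simp
    also have "\<dots> \<le> 2 * (2 * r) * \<mu>" unfolding \<mu>_def
      using diffn[OF v(1) v0(1)] nrm_nonneg[of T F u] by (intro mult_right_mono) auto
    finally show "\<bar>x\<bar> \<le> 4 * r * \<mu> / ?m" using lm v by (simp add: field_simps)
  next
    show "0 \<le> 4 * r * \<mu> / ?m" using lm mu r by simp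
  qed
  have "real (card S) \<le> (2 * (4 * r * \<mu> / ?m) + 2) * (4 * r / \<mu> + 2)"
  proof (rule card_le_fibres[OF fin _ lines])
    fix y assume "y \<in> t ` S"
    show "real (card {x \<in> S. t x = y}) \<le> 4 * r / \<mu> + 2"
    proof (rule card_line[OF T _ _ r, of u F])
      show "u \<noteq> 0" using u by simp
      show "nrm T F u = \<mu>" by (simp add: \<mu>_def)
      show "cross (v - w) u = 0" if "v \<in> {x \<in> S. t x = y}" "w \<in> {x \<in> S. t x = y}" for v w
        using tdiff[of v w] that by (simp add: scaled_def prod_eq_iff)
      show "\<mu> \<le> nrm T F (v - w)" if "v \<in> {x \<in> S. t x = y}" "w \<in> {x \<in> S. t x = y}" "v \<noteq> w" for v w
        unfolding \<mu>_def using that diffP u(2) by simp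
      show "nrm T F v \<le> r" if "v \<in> {x \<in> S. t x = y}" for v
        using that S by auto
    qed
  next
    show "0 \<le> 4 * r / \<mu> + 2" using mu lm r by simp
  qed
  also have "\<dots> = 32 * r\<^sup>2 / ?m + 16 * r * \<mu> / ?m + 8 * r / \<mu> + 4"
    using mu lm by (simp add: field_simps power2_eq_square)
  also have "\<dots> \<le> 32 * r\<^sup>2 / ?m + 16 * r * (2 * r) / ?m + 8 * r / ?l + 4"
    using mu lm r by (intro add_mono divide_right_mono divide_left_mono mult_left_mono) auto
  also have "\<dots> = 64 * r\<^sup>2 / ?m + 8 * r / ?l + 4"
    by (simp add: power2_eq_square)
  finally show ?thesis .
qed

text \<open>The cube is sliced by the planes on which the pairing with a shortest dual vector
  \<open>c\<close> is constant. Their number is O(r ?m + 1), and this ?m cancels the denominator in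
  the main term of \<open>card_plane\<close>, leaving r^3. The other occurrences of ?m in numerators
  are removed by \<open>lam_le_2\<close>.\<close>

lemma card_nrm_le:
  assumes T: "0 < T" and r: "1 \<le> r"
  shows "real (card {v. nrm T F v \<le> r}) \<le> 1000 * r\<^sup>2 * (r + 1 / lam T F + 1 / lam T (dual F))"
proof -
  let ?l = "lam T F" and ?m = "lam T (dual F)" and ?S = "{v. nrm T F v \<le> r}"
  have lm: "0 < ?l" "0 < ?m" "?m \<le> 2" using lam_pos[OF T] lam_le_2[OF T] by auto
  obtain c where c: "c \<noteq> 0" "nrm T (dual F) c = ?m" using lam_attained[OF T] .
  let ?B = "64 * r\<^sup>2 / ?m + 8 * r / ?l + 4"
  have planes: "real (card ((\<lambda>v. pairing v c) ` ?S)) \<le> 2 * (3 * r * ?m) + 2"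
  proof (rule card_separated[where h=of_int])
    fix x y :: int assume "x \<noteq> y"
    then show "1 \<le> \<bar>real_of_int x - real_of_int y\<bar>" by linarith
  next
    fix x assume "x \<in> (\<lambda>v. pairing v c) ` ?S"
    then obtain v where v: "nrm T F v \<le> r" "x = pairing v c" by blast
    have "\<bar>real_of_int x\<bar> \<le> 3 * nrm T F v * ?m" using pairing_le[OF T, of v c F] c v by simp
    also have "\<dots> \<le> 3 * r * ?m" using v lm by (intro mult_right_mono mult_left_mono) auto
    finally show "\<bar>real_of_int x\<bar> \<le> 3 * r * ?m" .
  next
    show "0 \<le> 3 * r * ?m" using lm r by simp
  qed
  have "real (card ?S) \<le> (2 * (3 * r * ?m) + 2) * ?B"
  proof (rule card_le_fibres[OF finite_nrm_le[OF T] _ planes])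
    fix k assume "k \<in> (\<lambda>v. pairing v c) ` ?S"
    show "real (card {x \<in> ?S. pairing x c = k}) \<le> ?B"
      using r by (intro card_plane[OF T _ c, of _ _ k]) auto
  next
    show "0 \<le> ?B" using lm r by simp
  qed
  also have "\<dots> = 384 * r ^ 3 + 48 * r\<^sup>2 * (?m / ?l) + 24 * (r * ?m) + 128 * r\<^sup>2 / ?m + 16 * r / ?l + 8"
    using lm by (simp add: field_simps power2_eq_square power3_eq_cube)
  also have "\<dots> \<le> 384 * r ^ 3 + 48 * r\<^sup>2 * (2 / ?l) + 24 * (r * 2) + 128 * r\<^sup>2 / ?m + 16 * r\<^sup>2 / ?l + 8"
    using lm r by (intro add_mono mult_left_mono divide_right_mono) (auto simp: self_le_power)
  also have "\<dots> \<le> 384 * r ^ 3 + 48 * r\<^sup>2 * (2 / ?l) + 48 * r ^ 3 + 128 * r\<^sup>2 / ?m + 16 * r\<^sup>2 / ?l + 8 * r ^ 3"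
    using r self_le_power[of r 3] one_le_power[of r 3] by linarith
  also have "\<dots> = r\<^sup>2 * (440 * r + 112 * (1 / ?l) + 128 * (1 / ?m))"
    by (simp add: field_simps power2_eq_square power3_eq_cube)
  also have "\<dots> \<le> r\<^sup>2 * (1000 * r + 1000 * (1 / ?l) + 1000 * (1 / ?m))"
    using lm r by (intro mult_left_mono add_mono mult_right_mono) auto
  finally show ?thesis by (simp add: algebra_simps)
qed

section \<open>Contraction along a curved path\<close>

lemma mean_value_within:
  fixes h :: "real \<Rightarrow> real"
  assumes "\<And>t. t \<in> {l..u} \<Longrightarrow> (h has_real_derivative h' t) (at t within {l..u})"
    and "l \<le> x" "x < y" "y \<le> u"
  obtains t where "x < t" "t < y" "h y - h x = h' t * (y - x)"
proof -
  have "\<exists>t\<in>{x<..<y}. h y - h x = (\<lambda>d. h' t * d) (y - x)"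
  proof (rule mvt_simple[OF assms(3)])
    fix t assume "x \<le> t" "t \<le> y"
    then have "(h has_real_derivative h' t) (at t within {x..y})"
      using assms by (intro DERIV_subset[OF assms(1)[of t]]) auto
    then show "(h has_derivative (\<lambda>d. h' t * d)) (at t within {x..y})"
      by (simp add: has_field_derivative_def)
  qed
  then show ?thesis using that by auto
qed

text \<open>A fixed integer vector seen along the path: \<open>A\<close> is |q|, while
  \<open>p\<close> and \<open>f\<close> are its second and third coordinates with signs normalised
  so that both derivatives have nonnegative factors. With speeds between \<open>c\<close> and
  \<open>C\<close>, \<open>f\<close> resembles a quadratic whose leading coefficient is comparable
  to \<open>A\<close>.\<close>

locale bent =
  fixes A c C l u :: real and p f g1 g2 :: "real \<Rightarrow> real"
  assumes A: "0 \<le> A" and c: "0 < c" "c \<le> 1" and C: "1 \<le> C"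
    and g: "\<And>t. t \<in> {l..u} \<Longrightarrow> c \<le> g1 t \<and> g1 t \<le> C \<and> c \<le> g2 t \<and> g2 t \<le> C"
    and p': "\<And>t. t \<in> {l..u} \<Longrightarrow> (p has_real_derivative g1 t * A) (at t within {l..u})"
    and f': "\<And>t. t \<in> {l..u} \<Longrightarrow> (f has_real_derivative g2 t * p t) (at t within {l..u})"
begin

lemma p_incr:
  assumes "l \<le> x" "x \<le> y" "y \<le> u"
  shows "c * A * (y - x) \<le> p y - p x" "p y - p x \<le> C * A * (y - x)"
proof -
  have "c * A * (y - x) \<le> p y - p x \<and> p y - p x \<le> C * A * (y - x)"
  proof (cases "x = y")
    case False
    then obtain t where t: "x < t" "t < y" "p y - p x = g1 t * A * (y - x)"
      using mean_value_within[OF p', of x y] assms by auto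
    have "c \<le> g1 t" "g1 t \<le> C" using g[of t] t assms by auto
    then show ?thesis unfolding t(3) using A assms by (auto intro!: mult_right_mono)
  qed auto
  then show "c * A * (y - x) \<le> p y - p x" "p y - p x \<le> C * A * (y - x)" by auto
qed

text \<open>Past a point where p \<ge> 0, p has gained at least c A (t - x), so f' \<ge> c^2 A (t -
  x). The mean value theorem for f minus the quadratic replaces integration. To the left of a point
  where p \<le> 0 the mirrored argument gives \<open>f_decr\<close>.\<close>

lemma f_incr:
  assumes "l \<le> x" "x \<le> y" "y \<le> u" "0 \<le> p x"
  shows "c\<^sup>2 * A / 2 * (y - x)\<^sup>2 \<le> f y - f x"
proof (cases "x = y")
  case False
  let ?h = "\<lambda>t. f t - c\<^sup>2 * A / 2 * (t - x)\<^sup>2"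
  have h': "(?h has_real_derivative g2 t * p t - c\<^sup>2 * A * (t - x)) (at t within {l..u})"
    if "t \<in> {l..u}" for t
    using f'[OF that] by (auto intro!: derivative_eq_intros simp: field_simps)
  then obtain t where t: "x < t" "t < y" "?h y - ?h x = (g2 t * p t - c\<^sup>2 * A * (t - x)) * (y - x)"
    using mean_value_within[OF h', of x y] False assms by auto
  have pt: "c * A * (t - x) \<le> p t" using p_incr(1)[of x t] t assms by auto
  have "0 \<le> c * A * (t - x)" using c A t by simp
  then have "c * (c * A * (t - x)) \<le> g2 t * p t"
    using g[of t] t assms pt c by (intro mult_mono) auto
  then have "0 \<le> (g2 t * p t - c\<^sup>2 * A * (t - x)) * (y - x)"
    using assms by (intro mult_nonneg_nonneg) (auto simp: power2_eq_square mult.assoc)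
  then show ?thesis using t(3) by simp
qed auto

lemma f_decr:
  assumes "l \<le> x" "x \<le> y" "y \<le> u" "p y \<le> 0"
  shows "c\<^sup>2 * A / 2 * (y - x)\<^sup>2 \<le> f x - f y"
proof (cases "x = y")
  case False
  let ?h = "\<lambda>t. f t - c\<^sup>2 * A / 2 * (y - t)\<^sup>2"
  have h': "(?h has_real_derivative g2 t * p t + c\<^sup>2 * A * (y - t)) (at t within {l..u})"
    if "t \<in> {l..u}" for t
    using f'[OF that] by (auto intro!: derivative_eq_intros simp: field_simps)
  then obtain t where t: "x < t" "t < y" "?h y - ?h x = (g2 t * p t + c\<^sup>2 * A * (y - t)) * (y - x)"
    using mean_value_within[OF h', of x y] False assms by auto
  have pt: "c * A * (y - t) \<le> - p t" using p_incr(1)[of t y] t assms by auto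
  have "0 \<le> c * A * (y - t)" using c A t by simp
  then have "c * (c * A * (y - t)) \<le> g2 t * (- p t)"
    using g[of t] t assms pt c by (intro mult_mono) auto
  then have "(g2 t * p t + c\<^sup>2 * A * (y - t)) * (y - x) \<le> 0"
    using assms by (intro mult_nonpos_nonneg) (auto simp: power2_eq_square mult.assoc)
  then show ?thesis using t(3) by simp
qed auto

lemma f_diff_le:
  assumes "l \<le> x" "x \<le> y" "y \<le> u" "\<And>t. x \<le> t \<Longrightarrow> t \<le> y \<Longrightarrow> \<bar>p t\<bar> \<le> B"
  shows "\<bar>f y - f x\<bar> \<le> C * B * (y - x)"
proof (cases "x = y")
  case False
  then obtain t where t: "x < t" "t < y" "f y - f x = g2 t * p t * (y - x)"
    using mean_value_within[OF f', of x y] assms by auto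
  have "\<bar>g2 t\<bar> * \<bar>p t\<bar> \<le> C * B"
    using g[of t] t assms c C by (intro mult_mono) auto
  then show ?thesis unfolding t(3) abs_mult using assms by (auto intro!: mult_right_mono)
qed auto

lemma f_diff_ge:
  assumes "l \<le> x" "x \<le> y" "y \<le> u" "\<And>t. x \<le> t \<Longrightarrow> t \<le> y \<Longrightarrow> B \<le> \<bar>p t\<bar>" "0 \<le> B"
  shows "c * B * (y - x) \<le> \<bar>f y - f x\<bar>"
proof (cases "x = y")
  case False
  then obtain t where t: "x < t" "t < y" "f y - f x = g2 t * p t * (y - x)"
    using mean_value_within[OF f', of x y] assms by auto
  have "c * B \<le> \<bar>g2 t\<bar> * \<bar>p t\<bar>"
    using g[of t] t assms c C by (intro mult_mono) auto
  then show ?thesis unfolding t(3) abs_mult using assms by (auto intro!: mult_right_mono)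
qed auto

definition extent :: "real \<Rightarrow> real \<Rightarrow> real" where
  "extent T x = max (A / T) (max \<bar>p x\<bar> (T * \<bar>f x\<bar>))"

lemma extent_bounds: "A / T \<le> extent T x" "\<bar>p x\<bar> \<le> extent T x" "T * \<bar>f x\<bar> \<le> extent T x"
  unfolding extent_def by simp_all

text \<open>The core of the contraction: among the K finer arcs only those near one index
  \<open>i0\<close> can see the vector short, and the length recovers quadratically away from it.
  The set \<open>J\<close> stays on one side of the zero of p because f may take equal values on
  both sides of its turning point.\<close>

lemma extent_growth:
  fixes K :: nat
  assumes T: "0 < T" and K: "1 \<le> K" and x: "l \<le> x" "x + 1 / T \<le> u" and m: "m = extent T x" "0 < m"
    and grid: "\<And>i. y i = x + real i / (real K * T)"
    and J: "J \<subseteq> {..<K}" "J \<noteq> {}" "(\<forall>i\<in>J. 0 \<le> p (y i)) \<or> (\<forall>i\<in>J. p (y i) \<le> 0)"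
  shows "\<exists>i0. \<forall>i\<in>J. c\<^sup>2 / (32 * C\<^sup>2) * m / real K * max 1 ((real i - real i0)\<^sup>2) \<le> extent (real K * T) (y i)"
proof -
  \<comment> \<open>If A/T < \<epsilon> m, then p varies over the arc by at most C A/T \<le> m/(8C),
    half of the threshold m/(4C) that separates cases 2 and 3. Below, \<nu> is c^2 / 2 times
    \<epsilon>, as the quadratic separation of case 1 dictates.\<close>
  define \<epsilon> where "\<epsilon> = 1 / (8 * C\<^sup>2)"
  define \<nu> where "\<nu> = c\<^sup>2 / (16 * C\<^sup>2)"
  have c2: "0 < c\<^sup>2" "c\<^sup>2 \<le> 1" "c\<^sup>2 \<le> c"
    using c by (auto simp: power_le_one) (simp add: power2_eq_square mult_left_le)
  have C2: "1 \<le> C\<^sup>2" "C \<le> C\<^sup>2" using C by (auto simp: one_le_power self_le_power)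
  have KT: "0 < real K * T" using K T by simp
  have y: "x \<le> y i" "y i \<le> x + 1 / T" "l \<le> y i" "y i \<le> u" if "i \<in> J" for i
  proof -
    have "real i / (real K * T) \<le> real K / (real K * T)"
      using that J KT by (intro divide_right_mono) auto
    also have "\<dots> = 1 / T" using K by simp
    finally show "x \<le> y i" "y i \<le> x + 1 / T" "l \<le> y i" "y i \<le> u"
      using x divide_nonneg_pos[OF of_nat_0_le_iff KT, of i] unfolding grid by linarith+
  qed
  have ydiff: "y i - y j = (real i - real j) / (real K * T)" for i j
    unfolding grid by (simp add: diff_divide_distrib)
  have dK: "\<bar>real i - real j\<bar> \<le> real K" if "i < K" "j < K" for i j
    using that by linarith
  have sq: "(real i - real j)\<^sup>2 \<le> real K * \<bar>real i - real j\<bar>" if "i < K" "j < K" for i j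
  proof -
    have "(real i - real j)\<^sup>2 = \<bar>real i - real j\<bar> * \<bar>real i - real j\<bar>"
      by (simp add: power2_eq_square)
    also have "\<dots> \<le> real K * \<bar>real i - real j\<bar>"
      using dK[OF that] by (intro mult_right_mono) auto
    finally show ?thesis .
  qed
  \<comment> \<open>The index \<open>i0\<close> minimises |f| on \<open>J\<close>, so |f (y i) - f
    (y i0)| \<le> 2 |f (y i)|, and a separation of values becomes a lower bound for each value. The
    factor 2 halves \<nu>; the assumption \<open>lower\<close> covers the part 1 of the
    maximum.\<close>
  have centre: ?thesis
    if lower: "\<And>i. i \<in> J \<Longrightarrow> \<nu> * m / real K \<le> extent (real K * T) (y i)"
      and sep: "\<And>i j. i \<in> J \<Longrightarrow> j \<in> J \<Longrightarrow> j \<le> i \<Longrightarrow>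
        \<nu> * m / real K * (real i - real j)\<^sup>2 \<le> real K * T * \<bar>f (y i) - f (y j)\<bar>"
  proof -
    have fin: "finite J" using J finite_subset by blast
    obtain i0 where i0: "i0 \<in> J" "\<And>i. i \<in> J \<Longrightarrow> \<bar>f (y i0)\<bar> \<le> \<bar>f (y i)\<bar>"
      using arg_min_if_finite[OF fin J(2), of "\<lambda>i. \<bar>f (y i)\<bar>"]
      by (metis linorder_not_less)
    have "c\<^sup>2 / (32 * C\<^sup>2) * m / real K * max 1 ((real i - real i0)\<^sup>2) \<le> extent (real K * T) (y i)"
      if i: "i \<in> J" for i
    proof -
      have "\<nu> * m / real K * (real i - real i0)\<^sup>2 \<le> real K * T * \<bar>f (y i) - f (y i0)\<bar>"
      proof (cases "i0 \<le> i")
        case True then show ?thesis using sep[OF i i0(1)] by simp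
      next
        case False then show ?thesis using sep[OF i0(1) i]
          by (simp add: abs_minus_commute power2_commute)
      qed
      also have "\<dots> \<le> real K * T * (2 * \<bar>f (y i)\<bar>)"
        using i0(2)[OF i] KT by (intro mult_left_mono) auto
      also have "\<dots> \<le> 2 * extent (real K * T) (y i)" using extent_bounds(3)[of "real K * T" "y i"] by simp
      finally have *: "\<nu> * m / real K * (real i - real i0)\<^sup>2 \<le> 2 * extent (real K * T) (y i)" .
      have half: "\<nu> / 2 * m / real K * z = \<nu> * m / real K * z / 2" for z by simp
      have half_le: "a / 2 \<le> b" if "a \<le> 2 * b" for a b :: real using that by linarith
      have 1: "\<nu> / 2 * m / real K * (real i - real i0)\<^sup>2 \<le> extent (real K * T) (y i)"
        unfolding half by (rule half_le[OF *])
      have "0 \<le> \<nu> * m / real K" using m unfolding \<nu>_def by simp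
      then have "\<nu> * m / real K * 1 \<le> 2 * extent (real K * T) (y i)" using lower[OF i] by simp
      then have 2: "\<nu> / 2 * m / real K * 1 \<le> extent (real K * T) (y i)"
        unfolding half by (rule half_le)
      have "\<nu> / 2 = c\<^sup>2 / (32 * C\<^sup>2)" by (simp add: \<nu>_def)
      then show ?thesis using 1 2 by (auto simp: max_def)
    qed
    then show ?thesis by blast
  qed
  have K1: "m / real K \<le> m" using K m by (simp add: divide_le_eq)
  consider (1) "\<epsilon> * m \<le> A / T" | (2) "A / T < \<epsilon> * m" "m / (4 * C) \<le> \<bar>p x\<bar>"
    | (3) "A / T < \<epsilon> * m" "\<bar>p x\<bar> < m / (4 * C)" by linarith
  then show ?thesis
  proof cases
    \<comment> \<open>The coordinate q is substantial: A/(K T) alone gives \<open>lower\<close>, and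
      curvature separates the values of f quadratically on either side of the zero of p.\<close>
    case 1
    show ?thesis
    proof (rule centre)
      fix i assume "i \<in> J"
      have "\<nu> * m / real K \<le> \<epsilon> * m / real K"
        using c2 C2 m by (intro divide_right_mono mult_right_mono) (auto simp: \<nu>_def \<epsilon>_def divide_simps)
      also have "\<dots> \<le> A / T / real K" using 1 by (intro divide_right_mono) auto
      also have "\<dots> \<le> extent (real K * T) (y i)"
        using extent_bounds(1)[of "real K * T" "y i"] by (simp add: mult.commute)
      finally show "\<nu> * m / real K \<le> extent (real K * T) (y i)" .
    next
      fix i j assume ij: "i \<in> J" "j \<in> J" "j \<le> i"
      have yy: "y j \<le> y i" using ydiff[of i j] ij KT by (simp add: grid divide_right_mono)
      have "\<nu> * m / real K * (real i - real j)\<^sup>2 = c\<^sup>2 / 2 * (real i - real j)\<^sup>2 / real K * (\<epsilon> * m)"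
        by (simp add: \<nu>_def \<epsilon>_def mult_ac)
      also have "\<dots> \<le> c\<^sup>2 / 2 * (real i - real j)\<^sup>2 / real K * (A / T)"
        using 1 by (intro mult_left_mono) auto
      also have "\<dots> = real K * T * (c\<^sup>2 * A / 2 * (y i - y j)\<^sup>2)"
        unfolding ydiff using T K by (simp add: field_simps power2_eq_square)
      also have "\<dots> \<le> real K * T * \<bar>f (y i) - f (y j)\<bar>"
      proof -
        have "c\<^sup>2 * A / 2 * (y i - y j)\<^sup>2 \<le> \<bar>f (y i) - f (y j)\<bar>"
          using J(3)
        proof
          assume "\<forall>i\<in>J. 0 \<le> p (y i)"
          then show ?thesis
            by (intro order_trans[OF f_incr abs_ge_self]) (use ij yy y in auto)
        next
          assume "\<forall>i\<in>J. p (y i) \<le> 0"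
          then show ?thesis unfolding abs_minus_commute[of "f (y i)"]
            by (intro order_trans[OF f_decr abs_ge_self]) (use ij yy y in auto)
        qed
        then show ?thesis using KT by (intro mult_left_mono) auto
      qed
      finally show "\<nu> * m / real K * (real i - real j)\<^sup>2 \<le> real K * T * \<bar>f (y i) - f (y j)\<bar>" .
    qed
  next
    \<comment> \<open>Here p stays at least m/(8C) in size along the whole arc, so f separates
      linearly in |i - j|. Since |i - j| \<le> K, this is stronger than a quadratic separation
      divided by K.\<close>
    case 2
    have pt: "m / (8 * C) \<le> \<bar>p t\<bar>" if "x \<le> t" "t \<le> x + 1 / T" for t
    proof -
      have "\<bar>p t - p x\<bar> \<le> C * A * (t - x)"
        using p_incr[of x t] that x A c by (smt (verit) mult_nonneg_nonneg)
      also have "\<dots> \<le> C * A * (1 / T)" using that A C by (intro mult_left_mono) auto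
      also have "\<dots> = C * (A / T)" by simp
      also have "\<dots> \<le> C * (\<epsilon> * m)" using 2(1) C by (intro mult_left_mono) auto
      also have "\<dots> = m / (8 * C)" using C by (simp add: \<epsilon>_def power2_eq_square)
      finally have "\<bar>p t - p x\<bar> \<le> m / (8 * C)" .
      moreover have "m / (4 * C) = m / (8 * C) + m / (8 * C)" using C by (simp add: field_simps)
      ultimately show ?thesis using 2(2) by linarith
    qed
    have \<nu>: "\<nu> \<le> 1 / (8 * C)" "\<nu> \<le> c / (8 * C)"
    proof -
      have "\<nu> \<le> c / (16 * C\<^sup>2)" unfolding \<nu>_def using c2 by (intro divide_right_mono) auto
      also have "\<dots> \<le> c / (8 * C)" using c C C2 by (intro divide_left_mono) auto
      finally show *: "\<nu> \<le> c / (8 * C)" .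
      also have "\<dots> \<le> 1 / (8 * C)" using c C by (intro divide_right_mono) auto
      finally show "\<nu> \<le> 1 / (8 * C)" .
    qed
    show ?thesis
    proof (rule centre)
      fix i assume i: "i \<in> J"
      have "\<nu> * m / real K = \<nu> * (m / real K)" by simp
      also have "\<dots> \<le> 1 / (8 * C) * m" using \<nu> K1 m C by (intro mult_mono) auto
      also have "\<dots> \<le> extent (real K * T) (y i)"
        using pt[of "y i"] y[OF i] extent_bounds(2)[of "y i" "real K * T"] by simp
      finally show "\<nu> * m / real K \<le> extent (real K * T) (y i)" .
    next
      fix i j assume ij: "i \<in> J" "j \<in> J" "j \<le> i"
      have yy: "y j \<le> y i" using ydiff[of i j] ij KT by (simp add: grid divide_right_mono)
      have "\<nu> * m / real K * (real i - real j)\<^sup>2 \<le> \<nu> * m / real K * (real K * \<bar>real i - real j\<bar>)"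
        using sq[of i j] ij J m c2 C2 by (intro mult_left_mono) (auto simp: \<nu>_def)
      also have "\<dots> = \<nu> * (m * (real i - real j))" using K ij by simp
      also have "\<dots> \<le> c / (8 * C) * (m * (real i - real j))" using \<nu> m ij by (intro mult_right_mono) auto
      also have "\<dots> = real K * T * (c * (m / (8 * C)) * (y i - y j))"
        unfolding ydiff using T K C by (simp add: field_simps)
      also have "\<dots> \<le> real K * T * \<bar>f (y i) - f (y j)\<bar>"
      proof -
        have "c * (m / (8 * C)) * (y i - y j) \<le> \<bar>f (y i) - f (y j)\<bar>"
          using y[OF ij(1)] y[OF ij(2)] yy pt m C by (intro f_diff_ge) auto
        then show ?thesis using KT by (intro mult_left_mono) auto
      qed
      finally show "\<nu> * m / real K * (real i - real j)\<^sup>2 \<le> real K * T * \<bar>f (y i) - f (y j)\<bar>" .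
    qed
  next
    \<comment> \<open>Neither q nor p can move f by more than m/(2T) on the arc, so T |f| \<ge> m/2
      throughout, and scale K T multiplies this by K. This beats even the maximal value K^2 of the
      square divided by K, so any centre would do; 0 is taken.\<close>
    case 3
    have C1: "m / (4 * C) \<le> m / 4" using m C by (intro divide_left_mono) auto
    have C1': "\<epsilon> * m < m"
    proof -
      have "\<epsilon> \<le> 1 / 8" using C2 by (simp add: \<epsilon>_def divide_le_eq)
      then have "\<epsilon> * m \<le> 1 / 8 * m" using m by (intro mult_right_mono) auto
      then show ?thesis using m by linarith
    qed
    have fx: "T * \<bar>f x\<bar> = m"
    proof -
      have "A / T < m" "\<bar>p x\<bar> < m" using 3 C1 C1' m(2) by linarith+
      moreover have "d = k" if "k = max a (max b d)" "a < k" "b < k" for a b d k :: real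
        using that by (auto simp: max_def split: if_splits)
      ultimately show ?thesis using m(1) unfolding extent_def by blast
    qed
    have pt: "\<bar>p t\<bar> \<le> m / (2 * C)" if "x \<le> t" "t \<le> x + 1 / T" for t
    proof -
      have "\<bar>p t - p x\<bar> \<le> C * A * (t - x)"
        using p_incr[of x t] that x A c by (smt (verit) mult_nonneg_nonneg)
      also have "\<dots> \<le> C * A * (1 / T)" using that A C by (intro mult_left_mono) auto
      also have "\<dots> = C * (A / T)" by simp
      also have "\<dots> \<le> C * (\<epsilon> * m)" using 3(1) C by (intro mult_left_mono) auto
      also have "\<dots> = m / (8 * C)" using C by (simp add: \<epsilon>_def power2_eq_square)
      also have "\<dots> \<le> m / (4 * C)" using m C by (intro divide_left_mono) auto
      finally have "\<bar>p t - p x\<bar> \<le> m / (4 * C)" .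
      moreover have "m / (2 * C) = m / (4 * C) + m / (4 * C)" using C by (simp add: field_simps)
      ultimately show ?thesis using 3(2) by linarith
    qed
    have "c\<^sup>2 / (32 * C\<^sup>2) * m / real K * max 1 ((real i - real 0)\<^sup>2) \<le> extent (real K * T) (y i)"
      if i: "i \<in> J" for i
    proof -
      have iK: "i < K" using i J by auto
      have "\<bar>f (y i) - f x\<bar> \<le> C * (m / (2 * C)) * (y i - x)"
        using y[OF i] x pt by (intro f_diff_le) auto
      also have "\<dots> \<le> C * (m / (2 * C)) * (1 / T)"
        using y[OF i] m C by (intro mult_left_mono) auto
      also have "\<dots> = m / 2 / T" using C by simp
      finally have "T * \<bar>f (y i) - f x\<bar> \<le> T * (m / 2 / T)" using T by (intro mult_left_mono) auto
      then have *: "T * \<bar>f (y i) - f x\<bar> \<le> m / 2" using T by simp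
      have "T * \<bar>f x\<bar> \<le> T * (\<bar>f (y i)\<bar> + \<bar>f (y i) - f x\<bar>)" using T by (intro mult_left_mono) auto
      then have "m / 2 \<le> T * \<bar>f (y i)\<bar>" using * fx by (simp add: distrib_left)
      then have "real K * (m / 2) \<le> real K * (T * \<bar>f (y i)\<bar>)" by (intro mult_left_mono) auto
      then have s: "real K * (m / 2) \<le> extent (real K * T) (y i)"
        using extent_bounds(3)[of "real K * T" "y i"] by (simp add: mult.assoc)
      have "(real i)\<^sup>2 \<le> (real K)\<^sup>2" using iK by (intro power_mono) auto
      moreover have "1 \<le> (real K)\<^sup>2" using K by simp
      ultimately have mx: "max 1 ((real i - real 0)\<^sup>2) \<le> (real K)\<^sup>2" by simp
      have cc: "c\<^sup>2 / (32 * C\<^sup>2) \<le> 1 / 2" using c2 C2 by (simp add: divide_le_eq)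
      have "c\<^sup>2 / (32 * C\<^sup>2) * m / real K * max 1 ((real i - real 0)\<^sup>2) \<le> 1 / 2 * m / real K * (real K)\<^sup>2"
        using mx cc m by (intro mult_mono divide_right_mono) auto
      also have "\<dots> = real K * (m / 2)" using K by (simp add: power2_eq_square)
      finally show ?thesis using s by linarith
    qed
    then show ?thesis by blast
  qed
qed

end

lemma sum_max_square_powr_le:
  assumes "1 / 2 < s"
  obtains Z :: real where "0 < Z"
    "\<And>(J :: nat set) i0. finite J \<Longrightarrow> (\<Sum>i\<in>J. max 1 ((real i - real i0)\<^sup>2) powr - s) \<le> Z"
proof -
  define g :: "nat \<Rightarrow> real" where "g d = max 1 ((real d)\<^sup>2) powr - s" for d
  have g0: "0 \<le> g d" for d by (simp add: g_def)
  have "summable (\<lambda>d. real d powr (- 2 * s))"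
    using assms by (subst summable_real_powr_iff) simp
  moreover have "\<forall>\<^sub>F d in sequentially. real d powr (- 2 * s) = g d"
  proof (rule eventually_sequentiallyI[of 1])
    fix d :: nat assume d: "1 \<le> d"
    then have *: "max 1 ((real d)\<^sup>2) = real d powr 2" by (simp add: powr_numeral)
    show "real d powr (- 2 * s) = g d" unfolding g_def * powr_powr by simp
  qed
  ultimately have sg: "summable g" using summable_cong by metis
  have part: "(\<Sum>i\<in>J. g (h i)) \<le> suminf g" if "finite J" "inj_on h J" for J :: "nat set" and h
  proof -
    have "(\<Sum>i\<in>J. g (h i)) = sum g (h ` J)" using that by (simp add: sum.reindex)
    also have "\<dots> \<le> suminf g" using that g0 by (intro sum_le_suminf sg) auto
    finally show ?thesis .
  qed
  have "(\<Sum>i\<in>J. max 1 ((real i - real i0)\<^sup>2) powr - s) \<le> 2 * suminf g + 1" if "finite J" for J i0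
  proof -
    let ?t = "\<lambda>i. max 1 ((real i - real i0)\<^sup>2) powr - s"
    let ?J1 = "{i \<in> J. i0 \<le> i}" and ?J2 = "{i \<in> J. i < i0}"
    have "J = ?J1 \<union> ?J2" by auto
    then have "sum ?t J = sum ?t ?J1 + sum ?t ?J2"
      using that by (subst sum.union_disjoint[symmetric]) auto
    moreover have "sum ?t ?J1 = (\<Sum>i\<in>?J1. g (i - i0))"
      by (rule sum.cong) (auto simp: g_def of_nat_diff)
    moreover have "sum ?t ?J2 = (\<Sum>i\<in>?J2. g (i0 - i))"
      by (rule sum.cong) (auto simp: g_def of_nat_diff power2_commute)
    moreover have "(\<Sum>i\<in>?J1. g (i - i0)) \<le> suminf g" "(\<Sum>i\<in>?J2. g (i0 - i)) \<le> suminf g"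
      using that by (intro part; auto simp: inj_on_def)+
    ultimately show ?thesis by linarith
  qed
  moreover have "0 < 2 * suminf g + 1" using suminf_nonneg[OF sg g0] by linarith
  ultimately show ?thesis using that by blast
qed

text \<open>A curve with nonvanishing curvature and its dual both give rise to such paths.\<close>

definition regular_path :: "(real \<Rightarrow> frame) \<Rightarrow> real \<Rightarrow> real \<Rightarrow> real \<Rightarrow> real \<Rightarrow> bool" where
  "regular_path G l u c C \<longleftrightarrow> (\<exists>g1 g2 :: real \<Rightarrow> real. \<exists>\<sigma>1 \<sigma>2 :: real. \<bar>\<sigma>1\<bar> = 1 \<and> \<bar>\<sigma>2\<bar> = 1 \<and>
    (\<forall>t\<in>{l..u}. c \<le> g1 t \<and> g1 t \<le> C \<and> c \<le> g2 t \<and> g2 t \<le> C \<and>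
      (\<forall>v. ((\<lambda>t. psi (G t) v) has_real_derivative \<sigma>1 * g1 t * of_int (fst v)) (at t within {l..u}) \<and>
           ((\<lambda>t. phi (G t) v) has_real_derivative \<sigma>2 * g2 t * psi (G t) v) (at t within {l..u}))))"

text \<open>The sign \<open>e\<close> makes the derivative of p equal to g1 |q|, and the further
  factor \<sigma>2 makes that of f equal to g2 p. Lengths see only absolute values, so nothing is
  lost.\<close>

lemma regular_path_bent:
  assumes "regular_path G l u c C" "0 < c" "c \<le> 1" "1 \<le> C"
  obtains p f g1 g2 where "bent \<bar>of_int (fst v)\<bar> c C l u p f g1 g2"
    "\<And>x. \<bar>p x\<bar> = \<bar>psi (G x) v\<bar>" "\<And>x. \<bar>f x\<bar> = \<bar>phi (G x) v\<bar>"
proof -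
  obtain g1 g2 :: "real \<Rightarrow> real" and \<sigma>1 \<sigma>2 :: real where \<sigma>: "\<bar>\<sigma>1\<bar> = 1" "\<bar>\<sigma>2\<bar> = 1"
    and g: "\<And>t. t \<in> {l..u} \<Longrightarrow> c \<le> g1 t \<and> g1 t \<le> C \<and> c \<le> g2 t \<and> g2 t \<le> C"
    and d1: "\<And>t v. t \<in> {l..u} \<Longrightarrow>
      ((\<lambda>t. psi (G t) v) has_real_derivative \<sigma>1 * g1 t * of_int (fst v)) (at t within {l..u})"
    and d2: "\<And>t v. t \<in> {l..u} \<Longrightarrow>
      ((\<lambda>t. phi (G t) v) has_real_derivative \<sigma>2 * g2 t * psi (G t) v) (at t within {l..u})"
    using assms(1) unfolding regular_path_def by blast
  define e :: real where "e = (if fst v < 0 then - \<sigma>1 else \<sigma>1)"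
  have e: "\<bar>e\<bar> = 1" "e * \<sigma>1 * of_int (fst v) = \<bar>of_int (fst v)\<bar>"
    using \<sigma>(1) by (auto simp: e_def abs_if split: if_splits)
  have \<sigma>22: "\<sigma>2 * \<sigma>2 = 1" using \<sigma>(2) by (metis abs_mult_self_eq mult_1)
  define p where "p t = e * psi (G t) v" for t
  define f where "f t = e * \<sigma>2 * phi (G t) v" for t
  have "bent \<bar>of_int (fst v)\<bar> c C l u p f g1 g2"
  proof
    fix t assume t: "t \<in> {l..u}"
    have "(p has_real_derivative e * (\<sigma>1 * g1 t * of_int (fst v))) (at t within {l..u})"
      unfolding p_def by (intro DERIV_cmult d1 t)
    moreover have "e * (\<sigma>1 * g1 t * of_int (fst v)) = g1 t * \<bar>of_int (fst v)\<bar>"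
      unfolding e(2)[symmetric] by simp
    ultimately show "(p has_real_derivative g1 t * \<bar>of_int (fst v)\<bar>) (at t within {l..u})" by simp
    have "(f has_real_derivative e * \<sigma>2 * (\<sigma>2 * g2 t * psi (G t) v)) (at t within {l..u})"
      unfolding f_def by (intro DERIV_cmult d2 t)
    moreover have "e * \<sigma>2 * (\<sigma>2 * g2 t * psi (G t) v) = \<sigma>2 * \<sigma>2 * (g2 t * p t)"
      unfolding p_def by simp
    ultimately show "(f has_real_derivative g2 t * p t) (at t within {l..u})"
      unfolding \<sigma>22 by simp
    show "c \<le> g1 t \<and> g1 t \<le> C \<and> c \<le> g2 t \<and> g2 t \<le> C" using g[OF t] .
  qed (use assms in auto)
  moreover have "\<bar>p x\<bar> = \<bar>psi (G x) v\<bar>" "\<bar>f x\<bar> = \<bar>phi (G x) v\<bar>" for x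
    using e(1) \<sigma>(2) by (simp_all add: p_def f_def abs_mult)
  ultimately show ?thesis using that by blast
qed

text \<open>The constant \<open>C0\<close> is fixed before K, T, x and v. This order of quantifiers
  later permits a choice of K for which C0 K^s is a small fraction of the number K of finer
  arcs.\<close>

lemma regular_path_contraction:
  assumes reg: "regular_path G l u c C" "0 < c" "c \<le> 1" "1 \<le> C" and s: "1 / 2 < s"
  obtains C0 where "0 < C0"
    "\<And>K T x v. 1 \<le> K \<Longrightarrow> 0 < T \<Longrightarrow> l \<le> x \<Longrightarrow> x + 1 / T \<le> u \<Longrightarrow> v \<noteq> 0 \<Longrightarrow>
      (\<Sum>i<K. nrm (real K * T) (G (x + real i / (real K * T))) v powr - s)
        \<le> C0 * real K powr s * nrm T (G x) v powr - s"
proof -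
  obtain Z where Z: "0 < Z"
    "\<And>(J :: nat set) i0. finite J \<Longrightarrow> (\<Sum>i\<in>J. max 1 ((real i - real i0)\<^sup>2) powr - s) \<le> Z"
    using sum_max_square_powr_le[OF s] by metis
  define \<kappa> where "\<kappa> = c\<^sup>2 / (32 * C\<^sup>2)"
  have \<kappa>: "0 < \<kappa>" using assms by (simp add: \<kappa>_def)
  have "(\<Sum>i<K. nrm (real K * T) (G (x + real i / (real K * T))) v powr - s)
      \<le> 2 * Z * \<kappa> powr - s * real K powr s * nrm T (G x) v powr - s"
    if K: "1 \<le> K" and T: "0 < T" and x: "l \<le> x" "x + 1 / T \<le> u" and v: "v \<noteq> 0" for K :: nat and T x v
  proof -
    obtain p f g1 g2 where b: "bent \<bar>of_int (fst v)\<bar> c C l u p f g1 g2"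
      and pf: "\<And>x. \<bar>p x\<bar> = \<bar>psi (G x) v\<bar>" "\<And>x. \<bar>f x\<bar> = \<bar>phi (G x) v\<bar>"
      using regular_path_bent[OF reg, of v] by metis
    interpret bent "\<bar>of_int (fst v)\<bar>" c C l u p f g1 g2 by (rule b)
    have ext: "extent T x = nrm T (G x) v" for T x
      by (simp add: extent_def nrm_def pf)
    define y where "y i = x + real i / (real K * T)" for i
    define m where "m = extent T x"
    have m: "0 < m" using nrm_pos[OF T v] by (simp add: m_def ext)
    define B where "B = \<kappa> * m / real K"
    have B: "0 < B" using \<kappa> m K by (simp add: B_def)
    have part: "(\<Sum>i\<in>J. extent (real K * T) (y i) powr - s) \<le> B powr - s * Z"
      if J: "J \<subseteq> {..<K}" "(\<forall>i\<in>J. 0 \<le> p (y i)) \<or> (\<forall>i\<in>J. p (y i) \<le> 0)" for J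
    proof (cases "J = {}")
      case True
      then show ?thesis using B Z by simp
    next
      case False
      obtain i0 where i0: "\<And>i. i \<in> J \<Longrightarrow>
          B * max 1 ((real i - real i0)\<^sup>2) \<le> extent (real K * T) (y i)"
        using extent_growth[OF T K x m_def m y_def J(1) False J(2)] unfolding B_def \<kappa>_def by blast
      have "(\<Sum>i\<in>J. extent (real K * T) (y i) powr - s)
          \<le> (\<Sum>i\<in>J. B powr - s * max 1 ((real i - real i0)\<^sup>2) powr - s)"
      proof (rule sum_mono)
        fix i assume "i \<in> J"
        then have "extent (real K * T) (y i) powr - s \<le> (B * max 1 ((real i - real i0)\<^sup>2)) powr - s"
          using s B by (intro powr_mono2' i0 mult_pos_pos) (auto simp: less_max_iff_disj)
        also have "\<dots> = B powr - s * max 1 ((real i - real i0)\<^sup>2) powr - s"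
          using B by (intro powr_mult)
        finally show "extent (real K * T) (y i) powr - s
            \<le> B powr - s * max 1 ((real i - real i0)\<^sup>2) powr - s" .
      qed
      also have "\<dots> = B powr - s * (\<Sum>i\<in>J. max 1 ((real i - real i0)\<^sup>2) powr - s)"
        by (rule sum_distrib_left[symmetric])
      also have "\<dots> \<le> B powr - s * Z"
        using J(1) finite_subset by (intro mult_left_mono Z(2)) auto
      finally show ?thesis .
    qed
    \<comment> \<open>On each of the two sets p has a constant sign, as \<open>extent_growth\<close>
      demands; each set may have its own centre, whence the factor 2 in the constant.\<close>
    let ?J1 = "{i. i < K \<and> 0 \<le> p (y i)}" and ?J2 = "{i. i < K \<and> p (y i) < 0}"
    have split: "{..<K} = ?J1 \<union> ?J2" by auto
    have "(\<Sum>i<K. extent (real K * T) (y i) powr - s)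
        = (\<Sum>i\<in>?J1. extent (real K * T) (y i) powr - s) + (\<Sum>i\<in>?J2. extent (real K * T) (y i) powr - s)"
      unfolding split by (rule sum.union_disjoint) auto
    also have "\<dots> \<le> B powr - s * Z + B powr - s * Z"
      by (intro add_mono part) auto
    also have "\<dots> = 2 * Z * \<kappa> powr - s * real K powr s * m powr - s"
    proof -
      have "B powr - s = \<kappa> powr - s * m powr - s / real K powr - s"
        unfolding B_def using \<kappa> m K by (simp add: powr_mult powr_divide)
      also have "\<dots> = \<kappa> powr - s * m powr - s * real K powr s"
        by (simp add: powr_minus_divide)
      finally show ?thesis by simp
    qed
    finally show ?thesis by (simp add: m_def ext y_def)
  qed
  moreover have "0 < 2 * Z * \<kappa> powr - s" using Z \<kappa> by simp
  ultimately show ?thesis using that by blast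
qed

text \<open>The weights 1/T, 1, T fit a displacement 1/T: psi changes by at most C |q| / T, and T
  phi by at most C times the largest |psi| on the way. The two successive estimates account for the
  square of 1 + C.\<close>

lemma regular_path_distortion:
  assumes reg: "regular_path G l u c C" "0 < c" "c \<le> 1" "1 \<le> C"
    and T: "0 < T" and xy: "x \<in> {l..u}" "y \<in> {l..u}" "\<bar>y - x\<bar> \<le> 1 / T"
  shows "nrm T (G y) v \<le> (1 + C)\<^sup>2 * nrm T (G x) v"
proof -
  obtain p f g1 g2 where b: "bent \<bar>of_int (fst v)\<bar> c C l u p f g1 g2"
    and pf: "\<And>x. \<bar>p x\<bar> = \<bar>psi (G x) v\<bar>" "\<And>x. \<bar>f x\<bar> = \<bar>phi (G x) v\<bar>"
    using regular_path_bent[OF reg, of v] by metis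
  interpret bent "\<bar>of_int (fst v)\<bar>" c C l u p f g1 g2 by (rule b)
  let ?n = "nrm T (G x) v" and ?A = "\<bar>real_of_int (fst v)\<bar>"
  have n0: "0 \<le> ?n" by (rule nrm_nonneg)
  have A_le: "?A / T \<le> ?n" and p_le: "\<bar>p x\<bar> \<le> ?n" and f_le: "T * \<bar>f x\<bar> \<le> ?n"
    using nrm_bounds[where T=T and F="G x" and v=v] by (auto simp: pf)
  have pt: "\<bar>p t\<bar> \<le> (1 + C) * ?n" if t: "t \<in> {l..u}" "\<bar>t - x\<bar> \<le> 1 / T" for t
  proof -
    have "\<bar>p t - p x\<bar> \<le> C * ?A * \<bar>t - x\<bar>"
    proof (cases "x \<le> t")
      case True
      have "0 \<le> c * ?A * (t - x)" using True c by simp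
      then show ?thesis using p_incr[of x t] t xy True by auto
    next
      case False
      have "0 \<le> c * ?A * (x - t)" using False c by simp
      then show ?thesis using p_incr[of t x] t xy False by auto
    qed
    also have "\<dots> \<le> C * ?A * (1 / T)" using t C by (intro mult_left_mono) auto
    also have "\<dots> = C * (?A / T)" by simp
    also have "\<dots> \<le> C * ?n" using A_le C by (intro mult_left_mono) auto
    finally show ?thesis using p_le by (simp add: distrib_right)
  qed
  have "\<bar>f y - f x\<bar> \<le> C * ((1 + C) * ?n) * \<bar>y - x\<bar>"
  proof (cases "x \<le> y")
    case True
    then show ?thesis using f_diff_le[of x y "(1 + C) * ?n"] xy pt by auto
  next
    case False
    then show ?thesis using f_diff_le[of y x "(1 + C) * ?n"] xy pt by (auto simp: abs_minus_commute)
  qed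
  also have "\<dots> \<le> C * ((1 + C) * ?n) * (1 / T)"
    using xy C n0 by (intro mult_left_mono) auto
  finally have "T * \<bar>f y - f x\<bar> \<le> T * (C * ((1 + C) * ?n) * (1 / T))"
    using T by (intro mult_left_mono) auto
  then have df: "T * \<bar>f y - f x\<bar> \<le> C * ((1 + C) * ?n)" using T by simp
  have "T * \<bar>f y\<bar> \<le> T * (\<bar>f y - f x\<bar> + \<bar>f x\<bar>)" using T by (intro mult_left_mono) auto
  then have "T * \<bar>f y\<bar> \<le> C * ((1 + C) * ?n) + ?n" using df f_le by (simp add: distrib_left)
  also have "\<dots> \<le> (1 + C)\<^sup>2 * ?n"
    using n0 C by (simp add: power2_eq_square algebra_simps)
  finally have 3: "T * \<bar>f y\<bar> \<le> (1 + C)\<^sup>2 * ?n" .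
  have sq: "1 + C \<le> (1 + C)\<^sup>2" "1 \<le> (1 + C)\<^sup>2" using C by (auto simp: self_le_power one_le_power)
  have 2: "\<bar>p y\<bar> \<le> (1 + C)\<^sup>2 * ?n"
    using pt[OF xy(2,3)] mult_right_mono[OF sq(1) n0] by linarith
  have 1: "?A / T \<le> (1 + C)\<^sup>2 * ?n"
    using A_le mult_right_mono[OF sq(2) n0] by linarith
  show ?thesis unfolding nrm_le_iff using 1 2 3 by (simp add: pf)
qed

section \<open>Recursion for shortest vectors from one scale to the next\<close>

lemma nrm_rescale:
  assumes "0 < T" "1 \<le> K" shows "nrm T F v \<le> K * nrm (K * T) F v"
proof -
  note b = nrm_bounds[where T="K * T" and F=F and v=v]
  have n: "nrm (K * T) F v \<le> K * nrm (K * T) F v"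
    using assms nrm_nonneg[of "K * T" F v] mult_right_mono[of 1 K "nrm (K * T) F v"] by simp
  have "\<bar>of_int (fst v)\<bar> / T = K * (\<bar>of_int (fst v)\<bar> / (K * T))" using assms by simp
  also have "\<dots> \<le> K * nrm (K * T) F v" using b(1) assms by (intro mult_left_mono) auto
  finally have 1: "\<bar>of_int (fst v)\<bar> / T \<le> K * nrm (K * T) F v" .
  have "T * \<bar>phi F v\<bar> \<le> K * T * \<bar>phi F v\<bar>" using assms by (intro mult_right_mono) auto
  then have 3: "T * \<bar>phi F v\<bar> \<le> K * nrm (K * T) F v" using b(3) n by linarith
  show ?thesis unfolding nrm_le_iff using 1 3 b(2) n by auto
qed

text \<open>A shortest vector at the finer scale is either parallel to the shortest vector at the coarser
  scale, or both together span a plane, which is a short vector of the dual lattice.\<close>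

lemma lam_child:
  assumes reg: "regular_path G l u c C" "0 < c" "c \<le> 1" "1 \<le> C" and s: "0 < s"
    and T: "0 < T" and K: "1 \<le> K" and xy: "x \<in> {l..u}" "y \<in> {l..u}" "\<bar>y - x\<bar> \<le> 1 / T"
    and v: "v \<noteq> 0" "nrm T (G x) v = lam T (G x)"
  shows "lam (K * T) (G y) powr - s \<le> nrm (K * T) (G y) v powr - s
    + (2 * (1 + C)\<^sup>2 * K) powr s * lam T (dual (G x)) powr - (s / 2)"
proof -
  have KT: "0 < K * T" using K T by simp
  obtain w where w: "w \<noteq> 0" "nrm (K * T) (G y) w = lam (K * T) (G y)" using lam_attained[OF KT] .
  have wx: "nrm T (G x) v \<le> nrm T (G x) w" using v(2) lam_le[OF w(1)] by simp
  show ?thesis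
  proof (cases "cross v w = 0")
    case True
    then obtain t where t: "scaled t v w" using scaled_of_cross_eq_0[OF _ v(1)] by blast
    \<comment> \<open>Minimality of \<open>v\<close> is known at the coarse scale only, but the
      ratio of parallel vectors is the same in every frame and at every scale.\<close>
    have "1 \<le> \<bar>t\<bar>"
      using wx nrm_scaled[OF t T, of "G x"] nrm_pos[OF T v(1), of "G x"] by simp
    then have "nrm (K * T) (G y) v \<le> nrm (K * T) (G y) w"
      using nrm_scaled[OF t KT, of "G y"] nrm_nonneg[of "K * T" "G y" v]
        mult_right_mono[of 1 "\<bar>t\<bar>" "nrm (K * T) (G y) v"] by simp
    then have "lam (K * T) (G y) powr - s \<le> nrm (K * T) (G y) v powr - s"
      using s w(2) nrm_pos[OF KT v(1), of "G y"] by (intro powr_mono2') auto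
    then show ?thesis by (smt (verit) mult_nonneg_nonneg powr_ge_zero)
  next
    case False
    define R where "R = 2 * (1 + C)\<^sup>2 * K"
    have R: "0 < R" using K assms(4) by (simp add: R_def)
    let ?\<mu> = "lam T (dual (G x))" and ?n = "nrm T (G x) w"
    have \<mu>: "0 < ?\<mu>" using lam_pos[OF T] .
    have "?\<mu> \<le> 2 * nrm T (G x) v * ?n"
      using lam_le[OF False, of T "dual (G x)"] nrm_cross[OF T, of "G x" v w] by linarith
    \<comment> \<open>As \<open>v\<close> is shortest at the coarse scale, the dual length bounds
      the square of the length of \<open>w\<close> from below. The square root taken next is the
      origin of the exponent s / 2.\<close>
    also have "\<dots> \<le> 2 * ?n * ?n"
      using wx nrm_nonneg[of T "G x" w] by (intro mult_right_mono mult_left_mono) auto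
    also have "\<dots> \<le> (2 * ?n)\<^sup>2" by (simp add: power2_eq_square)
    finally have "sqrt ?\<mu> \<le> 2 * ?n" using nrm_nonneg[of T "G x" w] by (intro real_le_lsqrt) auto
    also have "?n \<le> (1 + C)\<^sup>2 * nrm T (G y) w"
      using xy by (intro regular_path_distortion[OF reg T]) auto
    also have "\<dots> \<le> (1 + C)\<^sup>2 * (K * nrm (K * T) (G y) w)"
      using nrm_rescale[OF T K] by (intro mult_left_mono) auto
    finally have "sqrt ?\<mu> \<le> R * lam (K * T) (G y)" using w(2) by (simp add: R_def)
    then have "sqrt ?\<mu> / R \<le> lam (K * T) (G y)" using R by (simp add: divide_le_eq mult.commute)
    then have "lam (K * T) (G y) powr - s \<le> (sqrt ?\<mu> / R) powr - s"
      using s \<mu> R by (intro powr_mono2') auto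
    also have "\<dots> = R powr s * ?\<mu> powr - (s / 2)"
      using \<mu> R by (simp add: powr_half_sqrt[symmetric] powr_divide powr_powr powr_minus field_simps)
    finally show ?thesis unfolding R_def[symmetric] by (smt (verit) powr_ge_zero)
  qed
qed

text \<open>All finer arcs are compared with one and the same \<open>v\<close>, shortest on the
  coarse arc, so the contraction of a fixed vector applies to the whole sum, while the error
  \<open>M * X\<close> is the same for every arc.\<close>

lemma lam_children_sum:
  assumes reg: "regular_path G l u c C" "0 < c" "c \<le> 1" "1 \<le> C" and s: "0 < s"
    and contr: "\<And>K T x v. 1 \<le> K \<Longrightarrow> 0 < T \<Longrightarrow> l \<le> x \<Longrightarrow> x + 1 / T \<le> u \<Longrightarrow> v \<noteq> 0 \<Longrightarrow>
      (\<Sum>i<K. nrm (real K * T) (G (x + real i / (real K * T))) v powr - s)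
        \<le> C0 * real K powr s * nrm T (G x) v powr - s"
    and K: "1 \<le> K" "4 * C0 * real K powr s \<le> real K"
    and T: "0 < T" and x: "l \<le> x" "x + 1 / T \<le> u"
  shows "(\<Sum>i<K. lam (real K * T) (G (x + real i / (real K * T))) powr - s)
    \<le> real K * (1 / 4 * lam T (G x) powr - s + 1 / 4 * lam T (dual (G x)) powr - s
        + ((2 * (1 + C)\<^sup>2 * real K) powr s)\<^sup>2)"
proof -
  define M where "M = (2 * (1 + C)\<^sup>2 * real K) powr s"
  define X where "X = lam T (dual (G x)) powr - (s / 2)"
  have KT: "0 < real K * T" using K T by simp
  obtain v where v: "v \<noteq> 0" "nrm T (G x) v = lam T (G x)" using lam_attained[OF T] .
  have "(\<Sum>i<K. lam (real K * T) (G (x + real i / (real K * T))) powr - s)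
      \<le> (\<Sum>i<K. nrm (real K * T) (G (x + real i / (real K * T))) v powr - s + M * X)"
  proof (rule sum_mono)
    fix i assume i: "i \<in> {..<K}"
    have "real i / (real K * T) \<le> real K / (real K * T)"
      using i KT by (intro divide_right_mono) auto
    also have "\<dots> = 1 / T" using K by simp
    finally have "real i / (real K * T) \<le> 1 / T" .
    moreover have "0 \<le> real i / (real K * T)" using KT by simp
    moreover have "0 < 1 / T" using T by simp
    ultimately have "x \<in> {l..u}" "x + real i / (real K * T) \<in> {l..u}"
      "\<bar>x + real i / (real K * T) - x\<bar> \<le> 1 / T"
      using x unfolding atLeastAtMost_iff by linarith+
    then show "lam (real K * T) (G (x + real i / (real K * T))) powr - s
        \<le> nrm (real K * T) (G (x + real i / (real K * T))) v powr - s + M * X"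
      unfolding M_def X_def using K(1) by (intro lam_child[OF reg s T _ _ _ _ v]) auto
  qed
  also have "\<dots> = (\<Sum>i<K. nrm (real K * T) (G (x + real i / (real K * T))) v powr - s) + real K * (M * X)"
    by (simp add: sum.distrib)
  also have "\<dots> \<le> C0 * real K powr s * nrm T (G x) v powr - s + real K * (M * X)"
    by (intro add_right_mono contr K T x v)
  also have "\<dots> \<le> real K / 4 * lam T (G x) powr - s + real K * (X\<^sup>2 / 4 + M\<^sup>2)"
  proof (intro add_mono)
    show "C0 * real K powr s * nrm T (G x) v powr - s \<le> real K / 4 * lam T (G x) powr - s"
      unfolding v(2) using K by (intro mult_right_mono) auto
    \<comment> \<open>The weights give X^2 the factor 1/4, so that the recursions of the lattice and
      of its dual add up to the factor 1/2 < 1.\<close>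
    have "0 \<le> (X / 2 - M)\<^sup>2" by simp
    then have "M * X \<le> X\<^sup>2 / 4 + M\<^sup>2" by (simp add: power2_diff power_divide mult.commute)
    then show "real K * (M * X) \<le> real K * (X\<^sup>2 / 4 + M\<^sup>2)" by (intro mult_left_mono) auto
  qed
  also have "X\<^sup>2 = lam T (dual (G x)) powr - s"
    by (simp add: X_def power2_eq_square powr_add[symmetric])
  finally show ?thesis unfolding M_def by (simp add: algebra_simps)
qed

text \<open>The cross terms $\sqrt{\cdot}$ in the two recursions, for the lattice and its dual, are absorbed by the
  main terms of one another through the inequality of the means.\<close>

lemma lam_average_bounded:
  assumes reg: "regular_path G l u c C" "regular_path (\<lambda>x. dual (G x)) l u c C"
    and cC: "0 < c" "c \<le> 1" "1 \<le> C" and s: "1 / 2 < s" "s < 1" and lu: "l < u"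
  obtains K :: nat and D where "2 \<le> K" "0 < D"
    "\<And>n T. T = real K ^ n / (u - l) \<Longrightarrow>
      (\<Sum>i<K ^ n. lam T (G (l + real i / T)) powr - s + lam T (dual (G (l + real i / T))) powr - s)
        \<le> D * real K ^ n"
proof -
  obtain C1 where C1: "0 < C1"
    "\<And>K T x v. 1 \<le> K \<Longrightarrow> 0 < T \<Longrightarrow> l \<le> x \<Longrightarrow> x + 1 / T \<le> u \<Longrightarrow> v \<noteq> 0 \<Longrightarrow>
      (\<Sum>i<K. nrm (real K * T) (G (x + real i / (real K * T))) v powr - s)
        \<le> C1 * real K powr s * nrm T (G x) v powr - s"
    using regular_path_contraction[OF reg(1) cC s(1)] by metis
  obtain C2 where C2: "0 < C2"
    "\<And>K T x v. 1 \<le> K \<Longrightarrow> 0 < T \<Longrightarrow> l \<le> x \<Longrightarrow> x + 1 / T \<le> u \<Longrightarrow> v \<noteq> 0 \<Longrightarrow>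
      (\<Sum>i<K. nrm (real K * T) (dual (G (x + real i / (real K * T)))) v powr - s)
        \<le> C2 * real K powr s * nrm T (dual (G x)) v powr - s"
    using regular_path_contraction[OF reg(2) cC s(1)] by metis
  define C0 where "C0 = max C1 C2"
  have C0: "0 < C0" "C1 \<le> C0" "C2 \<le> C0" using C1 C2 by (auto simp: C0_def)
  \<comment> \<open>The large value achieves K^(1-s) \<ge> 4 C0, possible as s < 1; the value 2
    ensures that the scales K^n tend to infinity.\<close>
  define K where "K = max 2 (nat \<lceil>(4 * C0) powr (1 / (1 - s))\<rceil>)"
  have K: "2 \<le> K" "(4 * C0) powr (1 / (1 - s)) \<le> real K"
    unfolding K_def using real_nat_ceiling_ge[of "(4 * C0) powr (1 / (1 - s))"] by linarith+
  have "4 * C0 = ((4 * C0) powr (1 / (1 - s))) powr (1 - s)"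
    using s C0 by (simp add: powr_powr)
  also have "\<dots> \<le> real K powr (1 - s)" using K s by (intro powr_mono2) auto
  finally have "4 * C0 * real K powr s \<le> real K powr (1 - s) * real K powr s"
    by (intro mult_right_mono) auto
  also have "\<dots> = real K" using K by (simp add: powr_add[symmetric])
  finally have K4: "4 * C0 * real K powr s \<le> real K" .
  have K12: "4 * C1 * real K powr s \<le> real K" "4 * C2 * real K powr s \<le> real K"
    using order_trans[OF mult_right_mono K4] C0 by auto
  define M where "M = ((2 * (1 + C)\<^sup>2 * real K) powr s)\<^sup>2"
  have M: "0 \<le> M" by (simp add: M_def)
  define S where "S T x = lam T (G x) powr - s + lam T (dual (G x)) powr - s" for T x
  \<comment> \<open>With this scale the interval consists of exactly K^n arcs of length 1 / t n, and
    each of them of exactly K arcs of the next level.\<close>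
  define t where "t n = real K ^ n / (u - l)" for n
  have t: "0 < t n" "t (Suc n) = real K * t n" for n
    using K lu by (auto simp: t_def)
  have children: "(\<Sum>i<K. S (real K * T) (x + real i / (real K * T))) \<le> real K * (1 / 2 * S T x + 2 * M)"
    if T: "0 < T" "l \<le> x" "x + 1 / T \<le> u" for T x
  proof -
    have "(\<Sum>i<K. S (real K * T) (x + real i / (real K * T)))
      = (\<Sum>i<K. lam (real K * T) (G (x + real i / (real K * T))) powr - s)
      + (\<Sum>i<K. lam (real K * T) (dual (G (x + real i / (real K * T)))) powr - s)"
      unfolding S_def by (rule sum.distrib)
    also have "\<dots> \<le> real K * (1 / 4 * lam T (G x) powr - s + 1 / 4 * lam T (dual (G x)) powr - s + M)
      + real K * (1 / 4 * lam T (dual (G x)) powr - s + 1 / 4 * lam T (dual (dual (G x))) powr - s + M)"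
      unfolding M_def
      using s K by (intro add_mono lam_children_sum[OF reg(1) cC _ C1(2) _ K12(1)]
          lam_children_sum[OF reg(2) cC _ C2(2) _ K12(2)] T) auto
    also have "\<dots> = real K * (1 / 2 * S T x + 2 * M)" by (simp add: S_def algebra_simps)
    finally show ?thesis .
  qed
  define E where "E n = (\<Sum>i<K ^ n. S (t n) (l + real i / t n))" for n
  have step: "E (Suc n) \<le> real K * (1 / 2 * E n + real K ^ n * (2 * M))" for n
  proof -
    have "E (Suc n) = (\<Sum>j<K ^ n. \<Sum>i\<in>{j * K..<j * K + K}. S (t (Suc n)) (l + real i / t (Suc n)))"
      unfolding E_def power_Suc2 by (rule sum.nat_group[symmetric])
    also have "\<dots> = (\<Sum>j<K ^ n. \<Sum>i<K. S (t (Suc n)) (l + real (i + j * K) / t (Suc n)))"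
    proof (rule sum.cong[OF refl])
      fix j
      show "(\<Sum>i\<in>{j * K..<j * K + K}. S (t (Suc n)) (l + real i / t (Suc n)))
          = (\<Sum>i<K. S (t (Suc n)) (l + real (i + j * K) / t (Suc n)))"
        using sum.shift_bounds_nat_ivl[of "\<lambda>i. S (t (Suc n)) (l + real i / t (Suc n))" 0 "j * K" K]
        by (simp add: atLeast0LessThan add.commute)
    qed
    also have "\<dots> \<le> (\<Sum>j<K ^ n. real K * (1 / 2 * S (t n) (l + real j / t n) + 2 * M))"
    proof (rule sum_mono)
      fix j assume j: "j \<in> {..<K ^ n}"
      have eq: "l + real (i + j * K) / t (Suc n) = l + real j / t n + real i / (real K * t n)" for i
        using t(1)[of n] K unfolding t(2) by (simp add: field_simps)
      have "l + real j / t n + 1 / t n = l + real (j + 1) / t n" by (simp add: add_divide_distrib)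
      also have "\<dots> \<le> l + real K ^ n / t n"
      proof -
        have "j + 1 \<le> K ^ n" using j by simp
        then have "real (j + 1) \<le> real K ^ n" by (metis of_nat_le_iff of_nat_power)
        then show ?thesis using t(1)[of n] by (simp add: divide_right_mono)
      qed
      also have "\<dots> = u" using K lu by (simp add: t_def)
      finally show "(\<Sum>i<K. S (t (Suc n)) (l + real (i + j * K) / t (Suc n)))
          \<le> real K * (1 / 2 * S (t n) (l + real j / t n) + 2 * M)"
        unfolding eq unfolding t(2) using t(1)[of n] by (intro children) auto
    qed
    also have "\<dots> = real K * (1 / 2 * E n + real K ^ n * (2 * M))"
      unfolding sum_distrib_left[symmetric] sum.distrib E_def by simp
    finally show ?thesis .
  qed
  \<comment> \<open>The recursion maps a bound D to D / 2 + 2 M, which is at most D once D \<ge> 4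
    M; the summand \<open>E 0\<close> starts the induction, and 1 makes D positive.\<close>
  define D where "D = E 0 + 4 * M + 1"
  have E0: "0 \<le> E 0" by (simp add: E_def S_def)
  have bound: "E n \<le> D * real K ^ n" for n
  proof (induction n)
    case 0
    then show ?case using M by (simp add: D_def)
  next
    case (Suc n)
    have "E (Suc n) \<le> real K * (1 / 2 * (D * real K ^ n) + real K ^ n * (2 * M))"
    proof (rule order_trans[OF step])
      show "real K * (1 / 2 * E n + real K ^ n * (2 * M)) \<le> real K * (1 / 2 * (D * real K ^ n) + real K ^ n * (2 * M))"
        using Suc by (intro mult_left_mono add_right_mono) auto
    qed
    also have "\<dots> = (1 / 2 * D + 2 * M) * real K ^ Suc n" by (simp add: algebra_simps)
    also have "\<dots> \<le> D * real K ^ Suc n" using E0 by (intro mult_right_mono) (auto simp: D_def)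
    finally show ?case .
  qed
  show ?thesis
  proof (rule that[OF K(1)])
    show "0 < D" using E0 M by (simp add: D_def)
    show "(\<Sum>i<K ^ n. lam T (G (l + real i / T)) powr - s + lam T (dual (G (l + real i / T))) powr - s)
        \<le> D * real K ^ n" if "T = real K ^ n / (u - l)" for n T
      using bound[of n] unfolding E_def S_def t_def that .
  qed
qed

section \<open>Counting rational points near the curve\<close>

text \<open>For the curve, psi' = q and phi' = f'' psi; for the dual frame, psi' = - f'' q and phi'
  = - psi. Curvature thus passes from the second equation to the first, which explains the two
  speeds and two signs in \<open>regular_path\<close>.\<close>

lemma curve_regular_paths:
  fixes f f' f'' :: "real \<Rightarrow> real"
  assumes f: "\<And>x. x \<in> {l..u} \<Longrightarrow> (f has_real_derivative f' x) (at x within {l..u})"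
    and f': "\<And>x. x \<in> {l..u} \<Longrightarrow> (f' has_real_derivative f'' x) (at x within {l..u})"
    and \<sigma>: "\<bar>\<sigma>\<bar> = 1" "\<And>x. x \<in> {l..u} \<Longrightarrow> f'' x = \<sigma> * \<bar>f'' x\<bar>"
    and b: "\<And>x. x \<in> {l..u} \<Longrightarrow> c \<le> \<bar>f'' x\<bar> \<and> \<bar>f'' x\<bar> \<le> C" and cC: "c \<le> 1" "1 \<le> C"
  shows "regular_path (\<lambda>x. (x, f x, f' x)) l u c C"
    and "regular_path (\<lambda>x. dual (x, f x, f' x)) l u c C"
proof -
  note [derivative_intros] = f f'
  show "regular_path (\<lambda>x. (x, f x, f' x)) l u c C"
    unfolding regular_path_def
  proof (rule exI[of _ "\<lambda>_. 1"], rule exI[of _ "\<lambda>t. \<bar>f'' t\<bar>"], rule exI[of _ 1], rule exI[of _ \<sigma>],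
      intro conjI ballI allI)
    fix t and v :: ivec assume t: "t \<in> {l..u}"
    obtain q a e where v: "v = (q, a, e)" by (metis surj_pair)
    show "((\<lambda>t. psi (t, f t, f' t) v) has_real_derivative 1 * 1 * of_int (fst v)) (at t within {l..u})"
      unfolding v by (auto intro!: derivative_eq_intros)
    show "((\<lambda>t. phi (t, f t, f' t) v) has_real_derivative \<sigma> * \<bar>f'' t\<bar> * psi (t, f t, f' t) v)
        (at t within {l..u})"
      unfolding v \<sigma>(2)[OF t, symmetric]
      by (auto intro!: derivative_eq_intros t simp: algebra_simps)
  qed (use \<sigma> b cC in auto)
  show "regular_path (\<lambda>x. dual (x, f x, f' x)) l u c C"
    unfolding regular_path_def
  proof (rule exI[of _ "\<lambda>t. \<bar>f'' t\<bar>"], rule exI[of _ "\<lambda>_. 1"], rule exI[of _ "- \<sigma>"], rule exI[of _ "- 1"],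
      intro conjI ballI allI)
    fix t and v :: ivec assume t: "t \<in> {l..u}"
    obtain q a e where v: "v = (q, a, e)" by (metis surj_pair)
    have "- \<sigma> * \<bar>f'' t\<bar> * of_int (fst v) = - (f'' t * of_int (fst v))"
      by (subst (2) \<sigma>(2)[OF t]) simp
    then show "((\<lambda>t. psi (dual (t, f t, f' t)) v) has_real_derivative - \<sigma> * \<bar>f'' t\<bar> * of_int (fst v))
        (at t within {l..u})"
      unfolding v by (auto intro!: derivative_eq_intros t)
    show "((\<lambda>t. phi (dual (t, f t, f' t)) v) has_real_derivative - 1 * 1 * psi (dual (t, f t, f' t)) v)
        (at t within {l..u})"
      unfolding v by (auto intro!: derivative_eq_intros t simp: algebra_simps)
  qed (use \<sigma> b cC in auto)
qed

lemma near_curve_points_mono: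
  "\<delta> \<le> \<delta>' \<Longrightarrow> near_curve_points f \<eta> \<xi> Q \<delta> \<subseteq> near_curve_points f \<eta> \<xi> Q \<delta>'"
  by (auto simp: near_curve_points_def)

text \<open>Only powers with exponent s < 1 have bounded averages. The missing power 1 - s of
  1/\<lambda> is estimated pointwise by \<open>lam_ge\<close>, at the cost of T^(1-s).\<close>

lemma inverse_lam_le:
  assumes "0 < T0" "T0 \<le> T" "s < 1"
  shows "1 / lam T F \<le> (T / min 1 (min T0 (T0\<^sup>2))) powr (1 - s) * lam T F powr - s"
proof -
  let ?c = "min 1 (min T0 (T0\<^sup>2))"
  have c: "0 < ?c" "0 < T" using assms by auto
  have lam: "0 < lam T F" using lam_pos c by blast
  have "lam T F powr - (1 - s) \<le> (?c / T) powr - (1 - s)"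
    using assms c lam_ge[OF assms(1,2), of F] by (intro powr_mono2') auto
  also have "\<dots> = (T / ?c) powr (1 - s)"
  proof -
    have "T / ?c = inverse (?c / T)" by simp
    then show ?thesis unfolding powr_minus using c by (simp only: inverse_powr)
  qed
  finally have "lam T F powr - (1 - s) * lam T F powr - s \<le> (T / ?c) powr (1 - s) * lam T F powr - s"
    by (intro mult_right_mono) auto
  moreover have "lam T F powr - (1 - s) * lam T F powr - s = lam T F powr (- (1 - s) + - s)"
    by (rule powr_add[symmetric])
  moreover have "- (1 - s) + - s = - 1" by simp
  moreover have "lam T F powr - 1 = 1 / lam T F" using lam by (simp add: powr_minus_divide)
  ultimately show ?thesis by simp
qed

lemma near_curve_count_le:
  fixes f f' :: "real \<Rightarrow> real"
  defines "G \<equiv> \<lambda>x. (x, f x, f' x)"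
  assumes reg: "regular_path G \<eta> \<xi> c C" "regular_path (\<lambda>x. dual (G x)) \<eta> \<xi> c C"
    and cC: "0 < c" "c \<le> 1" "1 \<le> C" and s: "1 / 2 < s" "s < 1" and lu: "\<eta> < \<xi>"
  obtains B where "0 < B" "\<And>Q \<delta>. 0 < \<delta> \<Longrightarrow> \<delta> \<le> 1 \<Longrightarrow> 1 \<le> \<delta> * Q \<Longrightarrow>
    real (near_curve_count f \<eta> \<xi> Q \<delta>) \<le> B * (\<delta> * Q\<^sup>2 + \<delta> powr (s / 2) * Q powr (2 - s / 2))"
proof -
  obtain K :: nat and D where K: "2 \<le> K" and D: "0 < D"
    and avg: "\<And>n T. T = real K ^ n / (\<xi> - \<eta>) \<Longrightarrow>
      (\<Sum>i<K ^ n. lam T (G (\<eta> + real i / T)) powr - s + lam T (dual (G (\<eta> + real i / T))) powr - s)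
        \<le> D * real K ^ n"
    by (rule lam_average_bounded[OF reg cC s lu]) (rule that)
  define W where "W = \<xi> - \<eta>"
  have W: "0 < W" using lu by (simp add: W_def)
  define c0 where "c0 = min 1 (min (1 / W) ((1 / W)\<^sup>2))"
  have c0: "0 < c0" using W by (simp add: c0_def)
  define C2 where "C2 = 1 / W + real K"
  have C2: "0 < C2" using W K by (simp add: C2_def add_pos_pos)
  \<comment> \<open>The square of 1 + C is the distortion between a/q and the left end of its arc; 1
    + C2 covers both q / T \<le> r and T \<delta> \<le> C2 r.\<close>
  define C4 where "C4 = (1 + C)\<^sup>2 * (1 + C2)"
  have "1 * 1 \<le> C4" unfolding C4_def using cC C2 by (intro mult_mono) (auto simp: one_le_power)
  then have C4: "1 \<le> C4" by simp
  define P where "P = 1000 * C4\<^sup>2 * W * C2"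
  have P: "0 < P" using C4 W C2 by (simp add: P_def)
  define E where "E = D * (C2 / c0) powr (1 - s)"
  have E: "0 < E" using D C2 c0 by (simp add: E_def)
  have "real (near_curve_count f \<eta> \<xi> Q \<delta>)
      \<le> P * (C4 + E) * (\<delta> * Q\<^sup>2 + \<delta> powr (s / 2) * Q powr (2 - s / 2))"
    if \<delta>: "0 < \<delta>" "\<delta> \<le> 1" and \<delta>Q: "1 \<le> \<delta> * Q" for Q \<delta>
  proof -
    have Q: "1 \<le> Q"
    proof -
      have "0 < Q" using \<delta> \<delta>Q by (metis less_le_trans zero_less_mult_pos zero_less_one)
      then have "\<delta> * Q \<le> 1 * Q" using \<delta> by (intro mult_right_mono) auto
      then show ?thesis using \<delta>Q by simp
    qed
    define \<tau> where "\<tau> = sqrt (Q / \<delta>)"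
    define r where "r = sqrt (Q * \<delta>)"
    have \<tau>: "1 \<le> \<tau>" using \<delta> Q by (simp add: \<tau>_def le_divide_eq)
    have r: "1 \<le> r" using \<delta>Q by (simp add: r_def mult.commute)
    have \<tau>r: "\<tau> * \<delta> = r" "Q / \<tau> = r" "r * \<tau> = Q"
      using \<delta> Q by (auto simp: \<tau>_def r_def real_sqrt_divide real_sqrt_mult field_simps)
    obtain m where "\<tau> * W < real K ^ m" using real_arch_pow[of "real K" "\<tau> * W"] K by auto
    then have ex: "\<exists>m. \<tau> \<le> real K ^ m / W" using W by (intro exI[of _ m]) (simp add: field_simps)
    \<comment> \<open>The averages are controlled only at the scales K^n / W. The least such scale
      above \<tau> exceeds it by at most the factor K, or by at most 1/W if n = 0; \<open>C2\<close>
      dominates both.\<close>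
    define n where "n = (LEAST m. \<tau> \<le> real K ^ m / W)"
    define T where "T = real K ^ n / W"
    have \<tau>T: "\<tau> \<le> T" unfolding T_def n_def by (rule LeastI_ex[OF ex])
    then have T: "0 < T" using \<tau> by simp
    have T\<tau>: "T \<le> C2 * \<tau>"
    proof (cases n)
      case 0
      have "1 / W * 1 \<le> C2 * \<tau>" using \<tau> W by (intro mult_mono) (auto simp: C2_def)
      then show ?thesis by (simp add: T_def 0)
    next
      case (Suc k)
      have "\<not> \<tau> \<le> real K ^ k / W" using not_less_Least[of k "\<lambda>m. \<tau> \<le> real K ^ m / W"] Suc
        by (simp add: n_def)
      then have "real K * (real K ^ k / W) \<le> real K * \<tau>" by (intro mult_left_mono) auto
      then have "T \<le> real K * \<tau>" by (simp add: T_def Suc)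
      also have "\<dots> \<le> C2 * \<tau>" using \<tau> W by (intro mult_right_mono) (auto simp: C2_def)
      finally show ?thesis .
    qed
    have T0: "1 / W \<le> T" using K W by (simp add: T_def divide_right_mono)
    define x where "x i = \<eta> + real i / T" for i :: nat
    define R where "R = C4 * r"
    have R: "1 \<le> R" using mult_mono[of 1 C4 1 r] C4 r by (simp add: R_def)
    let ?V = "\<lambda>i. {v. nrm T (G (x i)) v \<le> R}"
    let ?\<pi> = "\<lambda>v :: ivec. (fst (snd v), nat (fst v))"
    have "near_curve_points f \<eta> \<xi> Q \<delta> \<subseteq> (\<Union>i<K ^ n. ?\<pi> ` ?V i)"
    proof
      fix z assume "z \<in> near_curve_points f \<eta> \<xi> Q \<delta>"
      then obtain a q where z: "z = (a, q)" and q: "1 \<le> q" "real q \<le> Q"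
        and a: "\<eta> * real q < of_int a" "of_int a \<le> \<xi> * real q"
        and near: "nearest_int_dist (real q * f (of_int a / real q)) < \<delta>"
        by (auto simp: near_curve_points_def)
      define w where "w = real_of_int a / real q"
      have w: "\<eta> < w" "w \<le> \<xi>" using a q by (auto simp: w_def field_simps)
      \<comment> \<open>Ceiling minus one makes the arcs open on the left and closed on the right,
        in accordance with \<eta> q < a \<le> \<xi> q: the endpoint \<xi> falls into the last arc
        and j is never negative.\<close>
      define j where "j = \<lceil>(w - \<eta>) * T\<rceil> - 1"
      have "0 < (w - \<eta>) * T" using w T by simp
      then have j0: "0 \<le> j" unfolding j_def by linarith
      have "(w - \<eta>) * T \<le> (\<xi> - \<eta>) * T" using w T by (intro mult_right_mono) auto
      also have "\<dots> = of_int (int (K ^ n))" using W by (simp add: T_def W_def)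
      finally have "\<lceil>(w - \<eta>) * T\<rceil> \<le> int (K ^ n)" by (simp only: ceiling_le_iff)
      then have jK: "nat j < K ^ n" using j0 unfolding j_def by linarith
      have j: "real (nat j) < (w - \<eta>) * T" "(w - \<eta>) * T \<le> real (nat j) + 1"
        using j0 unfolding j_def by linarith+
      have xj: "x (nat j) < w" "w - x (nat j) \<le> 1 / T" "\<eta> \<le> x (nat j)"
      proof -
        have "real (nat j) / T < w - \<eta>" using j(1) T by (simp add: pos_divide_less_eq)
        moreover have "w - \<eta> \<le> real (nat j) / T + 1 / T"
          using j(2) T unfolding add_divide_distrib[symmetric] by (simp add: pos_le_divide_eq)
        moreover have "0 \<le> real (nat j) / T" using T by simp
        ultimately show "x (nat j) < w" "w - x (nat j) \<le> 1 / T" "\<eta> \<le> x (nat j)"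
          unfolding x_def by linarith+
      qed
      \<comment> \<open>At the point w = a/q itself psi vanishes and phi is, up to sign, the
        rounding error of q f(w), which is less than \<delta>. The frame is moved to the left end of
        the arc afterwards.\<close>
      define v :: ivec where "v = (int q, a, round (real q * f w))"
      have "nrm T (G w) v \<le> (1 + C2) * r"
        unfolding nrm_le_iff
      proof (intro conjI)
        have "real q / T \<le> Q / \<tau>" using q \<tau> \<tau>T by (intro frac_le) auto
        also have "\<dots> \<le> (1 + C2) * r" using \<tau>r C2 r by simp
        finally show "\<bar>of_int (fst v)\<bar> / T \<le> (1 + C2) * r" by (simp add: v_def)
        show "\<bar>psi (G w) v\<bar> \<le> (1 + C2) * r"
          using q C2 r by (simp add: v_def G_def w_def)
        have psi: "real q * w - of_int a = 0" using q by (simp add: w_def)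
        have "\<bar>phi (G w) v\<bar> \<le> \<delta>"
          using near unfolding nearest_int_dist_def w_def[symmetric]
          by (simp add: v_def G_def psi abs_minus_commute)
        then have "T * \<bar>phi (G w) v\<bar> \<le> C2 * \<tau> * \<delta>"
          using T\<tau> \<delta> T \<tau> C2 by (intro mult_mono) auto
        also have "\<dots> \<le> (1 + C2) * r" using \<tau>r r by (simp add: mult.assoc distrib_right)
        finally show "T * \<bar>phi (G w) v\<bar> \<le> (1 + C2) * r" .
      qed
      then have "(1 + C)\<^sup>2 * nrm T (G w) v \<le> R"
        unfolding R_def C4_def mult.assoc by (intro mult_left_mono) auto
      then have "nrm T (G (x (nat j))) v \<le> R"
        using regular_path_distortion[OF reg(1) cC T, of w "x (nat j)" v] w xj by auto
      then have "v \<in> ?V (nat j)" by simp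
      moreover have "z = ?\<pi> v" by (simp add: z v_def)
      ultimately show "z \<in> (\<Union>i<K ^ n. ?\<pi> ` ?V i)" using jK by blast
    qed
    moreover have fin: "finite (?V i)" for i by (rule finite_nrm_le[OF T])
    ultimately have "near_curve_count f \<eta> \<xi> Q \<delta> \<le> card (\<Union>i<K ^ n. ?\<pi> ` ?V i)"
      unfolding near_curve_count_def by (intro card_mono) auto
    also have "\<dots> \<le> (\<Sum>i<K ^ n. card (?\<pi> ` ?V i))" by (intro card_UN_le) auto
    also have "\<dots> \<le> (\<Sum>i<K ^ n. card (?V i))" by (intro sum_mono card_image_le fin)
    finally have "real (near_curve_count f \<eta> \<xi> Q \<delta>) \<le> real (\<Sum>i<K ^ n. card (?V i))"
      by (rule of_nat_mono)
    also have "\<dots> = (\<Sum>i<K ^ n. real (card (?V i)))" by (rule of_nat_sum)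
    also have "\<dots> \<le> (\<Sum>i<K ^ n. 1000 * R\<^sup>2 * (R + (T / c0) powr (1 - s)
        * (lam T (G (x i)) powr - s + lam T (dual (G (x i))) powr - s)))"
    proof (rule sum_mono)
      fix i
      have inv: "1 / lam T F \<le> (T / c0) powr (1 - s) * lam T F powr - s" for F
        unfolding c0_def using W T0 s by (intro inverse_lam_le) auto
      have "1 / lam T (G (x i)) + 1 / lam T (dual (G (x i)))
        \<le> (T / c0) powr (1 - s) * (lam T (G (x i)) powr - s + lam T (dual (G (x i))) powr - s)"
        unfolding distrib_left by (intro add_mono inv)
      then have "R + 1 / lam T (G (x i)) + 1 / lam T (dual (G (x i)))
        \<le> R + (T / c0) powr (1 - s) * (lam T (G (x i)) powr - s + lam T (dual (G (x i))) powr - s)"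
        unfolding add.assoc by (rule add_left_mono)
      then show "real (card (?V i)) \<le> 1000 * R\<^sup>2 * (R + (T / c0) powr (1 - s)
        * (lam T (G (x i)) powr - s + lam T (dual (G (x i))) powr - s))"
        by (intro order_trans[OF card_nrm_le[OF T R]] mult_left_mono) auto
    qed
    also have "\<dots> = 1000 * R\<^sup>2 * (real (K ^ n) * R + (T / c0) powr (1 - s)
        * (\<Sum>i<K ^ n. lam T (G (x i)) powr - s + lam T (dual (G (x i))) powr - s))"
    proof -
      have "(\<Sum>i<N. a * (b + k * h i)) = a * (real N * b + k * (\<Sum>i<N. h i))"
        for N :: nat and a b k :: real and h
        by (simp add: sum_distrib_left[symmetric] sum.distrib)
      then show ?thesis by this
    qed
    also have "\<dots> \<le> 1000 * R\<^sup>2 * (real (K ^ n) * R + (T / c0) powr (1 - s) * (D * real K ^ n))"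
      unfolding x_def
      by (intro mult_left_mono add_left_mono avg) (auto simp: T_def W_def)
    also have "\<dots> = 1000 * R\<^sup>2 * W * T * (R + D * (T / c0) powr (1 - s))"
    proof -
      have "real K ^ n = W * T" using W by (simp add: T_def)
      then show ?thesis unfolding of_nat_power by (simp add: algebra_simps)
    qed
    also have "\<dots> \<le> 1000 * R\<^sup>2 * W * (C2 * \<tau>) * (R + D * (C2 * \<tau> / c0) powr (1 - s))"
    proof (rule mult_mono)
      have "(T / c0) powr (1 - s) \<le> (C2 * \<tau> / c0) powr (1 - s)"
        using T\<tau> T c0 s by (intro powr_mono2 divide_right_mono) auto
      then show "R + D * (T / c0) powr (1 - s) \<le> R + D * (C2 * \<tau> / c0) powr (1 - s)"
        using D by (intro add_left_mono mult_left_mono) auto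
      show "1000 * R\<^sup>2 * W * T \<le> 1000 * R\<^sup>2 * W * (C2 * \<tau>)"
        using T\<tau> W by (intro mult_left_mono) auto
      show "0 \<le> 1000 * R\<^sup>2 * W * (C2 * \<tau>)" using W C2 \<tau> by simp
      show "0 \<le> R + D * (T / c0) powr (1 - s)" using R D by simp
    qed
    also have "(C2 * \<tau> / c0) powr (1 - s) = (C2 / c0) powr (1 - s) * \<tau> powr (1 - s)"
      using C2 c0 \<tau> by (simp add: powr_mult[symmetric])
    also have "1000 * R\<^sup>2 * W * (C2 * \<tau>) * (R + D * ((C2 / c0) powr (1 - s) * \<tau> powr (1 - s)))
        = P * (C4 * (r ^ 3 * \<tau>) + E * (r\<^sup>2 * (\<tau> * \<tau> powr (1 - s))))"
      by (simp add: P_def E_def R_def algebra_simps power2_eq_square power3_eq_cube)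
    also have "r ^ 3 * \<tau> = \<delta> * Q\<^sup>2"
    proof -
      have "r ^ 3 * \<tau> = r\<^sup>2 * (r * \<tau>)" by (simp add: power2_eq_square power3_eq_cube)
      also have "r\<^sup>2 = Q * \<delta>" using Q \<delta> by (simp add: r_def)
      finally show ?thesis unfolding \<tau>r(3) by (simp add: power2_eq_square)
    qed
    also have "r\<^sup>2 * (\<tau> * \<tau> powr (1 - s)) = \<delta> powr (s / 2) * Q powr (2 - s / 2)"
    proof -
      have "\<tau> * \<tau> powr (1 - s) = \<tau> powr (2 - s)"
        using \<tau> powr_add[of \<tau> 1 "1 - s"] by simp
      also have "\<dots> = (Q / \<delta>) powr (1 - s / 2)"
        using Q \<delta> by (simp add: \<tau>_def powr_half_sqrt[symmetric] powr_powr field_simps)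
      also have "\<dots> = Q powr (1 - s / 2) * \<delta> powr (s / 2 - 1)"
        using Q \<delta> by (simp add: powr_divide powr_minus_divide[symmetric] divide_powr_uminus)
      finally have "r\<^sup>2 * (\<tau> * \<tau> powr (1 - s)) = (\<delta> powr 1 * \<delta> powr (s / 2 - 1)) * (Q powr 1 * Q powr (1 - s / 2))"
        using Q \<delta> by (simp add: r_def)
      then show ?thesis unfolding powr_add[symmetric] by simp
    qed
    also have "P * (C4 * (\<delta> * Q\<^sup>2) + E * (\<delta> powr (s / 2) * Q powr (2 - s / 2)))
        \<le> P * ((C4 + E) * (\<delta> * Q\<^sup>2) + (C4 + E) * (\<delta> powr (s / 2) * Q powr (2 - s / 2)))"
      using P C4 E \<delta> by (intro mult_left_mono add_mono mult_right_mono) auto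
    also have "\<dots> = P * (C4 + E) * (\<delta> * Q\<^sup>2 + \<delta> powr (s / 2) * Q powr (2 - s / 2))"
      by (simp only: distrib_left distrib_right mult.assoc)
    finally show ?thesis .
  qed
  note bound = this
  have "0 < P * (C4 + E)" using P C4 E by simp
  then show ?thesis by (rule that) (rule bound)
qed

section \<open>Interpolation and the range of small \<delta>\<close>

lemma near_curve_interpolation:
  fixes Q \<delta> \<theta> :: real
  assumes "0 < Q" "0 < \<delta>"
  shows "\<delta> powr ((1 + \<theta>) / 2 / 2) * Q powr (2 - (1 + \<theta>) / 2 / 2)
    \<le> (\<delta> * Q\<^sup>2 + \<delta> powr ((\<theta> - 1) / 2) * Q powr ((3 - \<theta>) / 2)) / 2" (is "?X \<le> (?A + ?B) / 2")
proof -
  have sq: "(x powr a)\<^sup>2 = x powr (2 * a)" for x a :: real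
    by (simp add: power2_eq_square flip: powr_add)
  have "?X\<^sup>2 = \<delta> powr ((1 + \<theta>) / 2) * Q powr (4 - (1 + \<theta>) / 2)"
    unfolding power_mult_distrib sq
    by (intro arg_cong2[of _ _ _ _ "(*)"] arg_cong2[of _ _ _ _ "(powr)"] refl) (simp_all add: field_simps)
  also have "\<dots> = \<delta> powr (1 + (\<theta> - 1) / 2) * Q powr (2 + (3 - \<theta>) / 2)"
    by (simp add: field_simps)
  also have "\<dots> = ?A * ?B"
    using assms by (simp add: powr_add powr_numeral)
  finally have X: "?X\<^sup>2 = ?A * ?B" .
  have "0 \<le> (?A - ?B)\<^sup>2" by simp
  then have "?X\<^sup>2 \<le> ((?A + ?B) / 2)\<^sup>2"
    unfolding X by (simp add: power2_eq_square algebra_simps)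
  then show ?thesis
  proof (rule power2_le_imp_le)
    show "0 \<le> (?A + ?B) / 2" using assms by simp
  qed
qed

theorem theorem1p3:
  fixes f f' f'' :: "real \<Rightarrow> real" and \<eta> \<xi> \<theta> \<epsilon> :: real
  assumes "\<eta> < \<xi>"
    and "\<And>x. x \<in> {\<eta>..\<xi>} \<Longrightarrow> (f has_real_derivative f' x) (at x within {\<eta>..\<xi>})"
    and "\<And>x. x \<in> {\<eta>..\<xi>} \<Longrightarrow> (f' has_real_derivative f'' x) (at x within {\<eta>..\<xi>})"
    and "continuous_on {\<eta>..\<xi>} f''"
    and "\<exists>c>0. \<forall>x\<in>{\<eta>..\<xi>}. c \<le> \<bar>f'' x\<bar>"
    and "0 < \<theta>" and "\<theta> < 1"
    and "holder_on \<theta> {\<eta>..\<xi>} f''"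
    and "0 < \<epsilon>"
  shows "\<exists>K>0. \<forall>Q \<delta> :: real. 1 \<le> Q \<and> 0 < \<delta> \<and> \<delta> < 1/2 \<longrightarrow>
    real (near_curve_count f \<eta> \<xi> Q \<delta>)
      \<le> K * (\<delta> * Q\<^sup>2 + \<delta> powr (- (1/2)) * Q powr (1/2 + \<epsilon>)
             + \<delta> powr ((\<theta> - 1) / 2) * Q powr ((3 - \<theta>) / 2))"
proof -
  obtain c where c: "0 < c" "\<And>x. x \<in> {\<eta>..\<xi>} \<Longrightarrow> c \<le> \<bar>f'' x\<bar>" using assms(5) by auto
  have "bounded (f'' ` {\<eta>..\<xi>})"
    by (intro compact_imp_bounded compact_continuous_image assms(4) compact_Icc)
  then obtain C where "\<forall>x\<in>{\<eta>..\<xi>}. \<bar>f'' x\<bar> \<le> C"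
    unfolding bounded_iff by auto
  then have C: "\<And>x. x \<in> {\<eta>..\<xi>} \<Longrightarrow> \<bar>f'' x\<bar> \<le> C" by blast
  \<comment> \<open>By connectedness f'' would vanish somewhere if it changed sign;
    \<open>regular_path\<close> asks for one sign along the whole path.\<close>
  have sign: "f'' x * f'' y > 0" if "x \<in> {\<eta>..\<xi>}" "y \<in> {\<eta>..\<xi>}" for x y
  proof (rule ccontr)
    assume "\<not> f'' x * f'' y > 0"
    then have "f'' x \<le> 0 \<and> 0 \<le> f'' y \<or> f'' y \<le> 0 \<and> 0 \<le> f'' x"
      by (auto simp: zero_less_mult_iff not_less)
    moreover have "connected (f'' ` {\<eta>..\<xi>})"
      using assms(4) by (intro connected_continuous_image) auto
    ultimately have "0 \<in> f'' ` {\<eta>..\<xi>}"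
      using that connectedD_interval[of "f'' ` {\<eta>..\<xi>}"] by blast
    then show False using c by force
  qed
  define \<sigma> where "\<sigma> = sgn (f'' \<eta>)"
  have \<sigma>: "\<bar>\<sigma>\<bar> = 1" "\<And>x. x \<in> {\<eta>..\<xi>} \<Longrightarrow> f'' x = \<sigma> * \<bar>f'' x\<bar>"
  proof -
    have "f'' \<eta> \<noteq> 0" using c(2)[of \<eta>] c(1) assms(1) by auto
    then show "\<bar>\<sigma>\<bar> = 1" by (simp add: \<sigma>_def sgn_if)
    show "f'' x = \<sigma> * \<bar>f'' x\<bar>" if "x \<in> {\<eta>..\<xi>}" for x
      using sign[OF _ that, of \<eta>] assms(1) by (cases "0 < f'' \<eta>") (auto simp: \<sigma>_def zero_less_mult_iff)
  qed
  \<comment> \<open>Both 1 and |f''| occur as speeds of the two paths, so the bounds must enclose 1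
    as well.\<close>
  define c' where "c' = min c 1"
  define C' where "C' = max C 1"
  have c'C': "0 < c'" "c' \<le> 1" "1 \<le> C'" using c by (auto simp: c'_def C'_def)
  have bounds: "\<And>x. x \<in> {\<eta>..\<xi>} \<Longrightarrow> c' \<le> \<bar>f'' x\<bar> \<and> \<bar>f'' x\<bar> \<le> C'"
    using c(2) C by (fastforce simp: c'_def C'_def)
  note reg = curve_regular_paths[OF assms(2,3) \<sigma> bounds c'C'(2,3)]
  have s: "1 / 2 < (1 + \<theta>) / 2" "(1 + \<theta>) / 2 < 1" using assms by auto
  obtain B where B: "0 < B" "\<And>Q \<delta>. 0 < \<delta> \<Longrightarrow> \<delta> \<le> 1 \<Longrightarrow> 1 \<le> \<delta> * Q \<Longrightarrow>
    real (near_curve_count f \<eta> \<xi> Q \<delta>)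
      \<le> B * (\<delta> * Q\<^sup>2 + \<delta> powr ((1 + \<theta>) / 2 / 2) * Q powr (2 - (1 + \<theta>) / 2 / 2))"
    using near_curve_count_le[OF reg c'C' s assms(1)] by metis
  let ?t = "\<lambda>Q \<delta>. \<delta> powr ((\<theta> - 1) / 2) * Q powr ((3 - \<theta>) / 2)"
  have main: "real (near_curve_count f \<eta> \<xi> Q \<delta>) \<le> 2 * B * (\<delta> * Q\<^sup>2 + ?t Q \<delta>)"
    if "0 < \<delta>" "\<delta> \<le> 1" "1 \<le> \<delta> * Q" for Q \<delta>
  proof -
    have Q: "0 < Q" using that by (metis less_le_trans zero_less_mult_pos zero_less_one)
    have "B * (\<delta> * Q\<^sup>2 + \<delta> powr ((1 + \<theta>) / 2 / 2) * Q powr (2 - (1 + \<theta>) / 2 / 2))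
        \<le> B * (\<delta> * Q\<^sup>2 + (\<delta> * Q\<^sup>2 + ?t Q \<delta>) / 2)"
      using B Q that by (intro mult_left_mono add_left_mono near_curve_interpolation) auto
    also have "\<dots> \<le> B * (2 * (\<delta> * Q\<^sup>2 + ?t Q \<delta>))"
      using B that by (intro mult_left_mono) (auto simp: field_simps)
    also have "\<dots> = 2 * B * (\<delta> * Q\<^sup>2 + ?t Q \<delta>)" by simp
    finally show ?thesis by (rule order_trans[OF B(2)[OF that]])
  qed
  have "real (near_curve_count f \<eta> \<xi> Q \<delta>) \<le> 4 * B * (\<delta> * Q\<^sup>2 + ?t Q \<delta>)"
    if Q: "1 \<le> Q" and \<delta>: "0 < \<delta>" "\<delta> < 1 / 2" for Q \<delta>
  proof (cases "1 \<le> \<delta> * Q")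
    case True
    have "2 * B * (\<delta> * Q\<^sup>2 + ?t Q \<delta>) \<le> 4 * B * (\<delta> * Q\<^sup>2 + ?t Q \<delta>)"
      using B \<delta> by (intro mult_right_mono) auto
    then show ?thesis using main[of \<delta> Q] True \<delta> by linarith
  next
    case False
    then have le: "\<delta> \<le> 1 / Q" using Q by (simp add: field_simps)
    have "near_curve_count f \<eta> \<xi> Q \<delta> \<le> near_curve_count f \<eta> \<xi> Q (1 / Q)"
      unfolding near_curve_count_def
      by (intro card_mono finite_near_curve_points near_curve_points_mono le)
    also have "real \<dots> \<le> 2 * B * (1 / Q * Q\<^sup>2 + ?t Q (1 / Q))"
      using Q by (intro main) auto
    also have "\<dots> \<le> 2 * B * (?t Q \<delta> + ?t Q \<delta>)"
    proof -
      have t1: "?t Q (1 / Q) \<le> ?t Q \<delta>"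
        using le \<delta> Q assms by (intro mult_right_mono powr_mono2') auto
      \<comment> \<open>At \<delta> = 1/Q the term \<delta> Q^2 equals Q and the last term equals
        Q^(2-\<theta>), which is at least Q since \<theta> < 1. The last term only grows when
        \<delta> decreases, so it absorbs both.\<close>
      have "1 / Q * Q\<^sup>2 = Q powr 1" using Q by (simp add: power2_eq_square)
      also have "\<dots> \<le> Q powr (2 - \<theta>)" using Q assms by (intro powr_mono) auto
      also have "2 - \<theta> = - ((\<theta> - 1) / 2) + (3 - \<theta>) / 2" by (simp add: field_simps)
      also have "Q powr \<dots> = ?t Q (1 / Q)"
      proof -
        have "Q powr - a = (1 / Q) powr a" for a
          using Q by (simp add: powr_divide powr_minus_divide)
        then show ?thesis unfolding powr_add by simp
      qed
      finally show ?thesis using t1 B by (intro mult_left_mono add_mono) auto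
    qed
    also have "\<dots> = 4 * B * ?t Q \<delta>" by simp
    also have "\<dots> \<le> 4 * B * (\<delta> * Q\<^sup>2 + ?t Q \<delta>)"
      using B \<delta> by (intro mult_left_mono) auto
    finally show ?thesis by simp
  qed
  note bound = this
  show ?thesis
  proof (rule exI[of _ "4 * B"], intro conjI allI impI)
    show "0 < 4 * B" using B by simp
    fix Q \<delta> :: real assume h: "1 \<le> Q \<and> 0 < \<delta> \<and> \<delta> < 1/2"
    have "4 * B * (\<delta> * Q\<^sup>2 + ?t Q \<delta>)
        \<le> 4 * B * (\<delta> * Q\<^sup>2 + \<delta> powr (- (1/2)) * Q powr (1/2 + \<epsilon>) + ?t Q \<delta>)"
      using B by (intro mult_left_mono) auto
    then show "real (near_curve_count f \<eta> \<xi> Q \<delta>)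
      \<le> 4 * B * (\<delta> * Q\<^sup>2 + \<delta> powr (- (1/2)) * Q powr (1/2 + \<epsilon>) + ?t Q \<delta>)"
      using bound[of Q \<delta>] h by linarith
  qed
qed

end
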